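(* Let $\mathbb{E}$ be the expectation making the configuration $\omega$ a Poisson random measure on $\mathbb{X}$ with control measure $\sigma$. Let $l\ge 1$ and $r_1,n_1,\ldots,r_l,n_l\ge 1$ be integers. Let $f_0\ge 0$ be a $0$-process (random variable) and, for $\alpha=1,\ldots,l$, let $f_\alpha\ge 0$ be an $r_\alpha$-process. Let $\epsilon_{(1)}\in\{0,1\}^{r_1},\ldots,\epsilon_{(l)}\in\{0,1\}^{r_l}$. Let $$S=\{(\alpha,\beta,\gamma):1\le\alpha\le l,\ 1\le\beta\le r_\alpha,\ 1\le\gamma\le n_\alpha\},$$ and for $s=(\alpha,\beta,\gamma)\in S$ define $\epsilon_s=\epsilon_{(\alpha)}(\beta)$, the $\beta$-th coordinate of $\epsilon_{(\alpha)}$. Then $$\mathbb{E}\left[f_0(\omega)\left(\int_{\mathbb{X}^{r_1}}f_1(y;\omega)\,\omega_{\epsilon_{(1)}}(dy)\right)^{n_1}\cdots\left(\int_{\mathbb{X}^{r_l}}f_l(y;\omega)\,\omega_{\epsilon_{(l)}}(dy)\right)^{n_l}\right]$$ $$=\sum_{P=\{P_1,\ldots,P_k\}\in\mathcal{P}^{\epsilon}(S)}\mathbb{E}\left[\int_{\mathbb{X}^k_{\neq}}f_0\Bigl(\omega\cup\bigcup_{s\in S:\,\epsilon_s=1}\{y^P_s\}\Bigr)\prod_{\alpha=1}^{l}\prod_{\gamma=1}^{n_\alpha}f_\alpha\Bigl(y^P_{S_{\alpha,\gamma}};\,\omega\cup\bigcup_{s\in S:\,\epsilon_s=1}\{y^P_s\}\Bigr)\,\sigma^k(dy)\right],$$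 where $k=k(P)$ is the number of blocks of $P$ and $y=(y_1,\ldots,y_k)$.
   Context: $\mathbb{X}$ is a locally compact separable metric space. A configuration is a locally finite subset $\omega\subset\mathbb{X}$; $\Omega$ is the set of all configurations. A configuration $\omega=\{y_1,y_2,\ldots\}$ (distinct points) is identified with the measure $\sum_i\delta_{y_i}$. $\mathcal{F}$ is the smallest $\sigma$-algebra on $\Omega$ making $\omega\mapsto\omega(A)$ measurable for each Borel $A\subset\mathbb{X}$. $\sigma$ is a non-atomic Borel measure on $\mathbb{X}$, finite on compact sets. $\mathbb{P}$ (with expectation $\mathbb{E}$) is the probability on $(\Omega,\mathcal{F})$ under which $\omega$ is a Poisson random measure with intensity measure $\sigma$. A $k$-process is a jointly measurable map $f:\mathbb{X}^k\times\Omega\to[-\infty,\infty]$, $(x_1,\ldots,x_k;\omega)\mapsto f(x_1,\ldots,x_k;\omega)$; a $0$-process is a random variable on $\Omega$. Notation: $\omega_1=\omega$ and $\omega_0=\sigma$; for $\eta\in\{0,1\}^r$, $\omega_{\eta}(dy)=\omega_{\eta_1}(dy_1)\cdots\omega_{\eta_r}(dy_r)$. $\sigma^k(dy)=\sigma(dy_1)\cdots\sigma(dy_k)$. $\mathbb{X}^k_{\neq}$ is the set of $(y_1,\ldots,y_k)\in\mathbb{X}^k$ with pairwise distinct coordinates ($\mathbb{X}^1_{\neq}=\mathbb{X}$). $\mathcal{P}(S)$ is the set of all partitions $P=\{P_1,\ldots,P_k\}$ of the finite set $S$ into nonempty pairwise disjoint blocks (the enumeration of blocks is arbitrary but fixed).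 For $\epsilon:S\to\{0,1\}$, $\mathcal{P}^{\epsilon}(S)$ is the set of those $P\in\mathcal{P}(S)$ such that every block with more than one element has $\epsilon_s=1$ for all its elements $s$. For $P=\{P_1,\ldots,P_k\}\in\mathcal{P}(S)$ and $y=(y_1,\ldots,y_k)\in\mathbb{X}^k$, $y^P\in\mathbb{X}^S$ is defined by $y^P_s=y_j$ if $s\in P_j$. For $1\le\alpha\le l$, $1\le\gamma\le n_\alpha$, $S_{\alpha,\gamma}=\{(\alpha,\beta,\gamma)\in S:1\le\beta\le r_\alpha\}$, and $y^P_{S_{\alpha,\gamma}}$ is the restriction of $y^P$ to $S_{\alpha,\gamma}$, identified with the vector $(y^P_{(\alpha,1,\gamma)},\ldots,y^P_{(\alpha,r_\alpha,\gamma)})\in\mathbb{X}^{r_\alpha}$. *)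

theory Defs
  imports "HOL-Probability.Probability" "HOL-Library.Disjoint_Sets"
begin

text \<open>The underlying space is a type of sort \<open>{metric_space, second_countable_topology}\<close>: for metric
  spaces second countability is separability.  Local compactness is the assumption
  \<open>locally_compact_space euclidean\<close>.\<close>

section \<open>Configurations\<close>

definition locally_finite_set :: "'a::topological_space set \<Rightarrow> bool" where
  "locally_finite_set \<omega> \<longleftrightarrow> (\<forall>x. \<exists>U. open U \<and> x \<in> U \<and> finite (\<omega> \<inter> U))"

definition configurations :: "'a::topological_space set set" where
  "configurations = {\<omega>. locally_finite_set \<omega>}"

text \<open>The measure \<open>\<Sum>\<^sub>i \<delta>\<^bsub>y\<^sub>i\<^esub>\<close> with which the configuration \<open>{y\<^sub>1, y\<^sub>2, \<dots>}\<close> is identified, as a measure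
  on the Borel sets: the push-forward of counting measure on the configuration under the inclusion.\<close>

definition config_measure :: "'a::topological_space set \<Rightarrow> 'a measure" where
  "config_measure \<omega> = distr (count_space \<omega>) borel (\<lambda>x. x)"

lemma emeasure_config_measure:
  assumes "A \<in> sets borel"
  shows "emeasure (config_measure \<omega>) A = emeasure (count_space UNIV) (\<omega> \<inter> A)"
proof -
  have "emeasure (config_measure \<omega>) A = emeasure (count_space \<omega>) (\<omega> \<inter> A)"
    using assms by (simp add: config_measure_def emeasure_distr Int_commute)
  also have "\<dots> = emeasure (count_space UNIV) (\<omega> \<inter> A)"
    by (simp add: emeasure_count_space)
  finally show ?thesis .
qed

definition config_space :: "'a::topological_space set measure" where
  "config_space = sigma configurations
     {{\<omega> \<in> configurations. emeasure (config_measure \<omega>) A \<in> B} | A B.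
        A \<in> sets borel \<and> B \<in> sets borel}"

section \<open>Poisson random measures\<close>

definition measure_atom :: "'a measure \<Rightarrow> 'a set \<Rightarrow> bool" where
  "measure_atom \<mu> A \<longleftrightarrow> A \<in> sets \<mu> \<and> emeasure \<mu> A > 0 \<and>
     (\<forall>B\<in>sets \<mu>. B \<subseteq> A \<longrightarrow> emeasure \<mu> B = 0 \<or> emeasure \<mu> (A - B) = 0)"

definition non_atomic :: "'a measure \<Rightarrow> bool" where
  "non_atomic \<mu> \<longleftrightarrow> (\<nexists>A. measure_atom \<mu> A)"

text \<open>The identity on \<open>configurations\<close> is, under \<open>P\<close>, a Poisson random measure with intensity \<open>\<sigma>\<close>.
  As usual, the Poisson distribution with infinite mean is the point mass at \<open>\<infinity>\<close>.\<close>

definition poisson_random_measure :: "'a::topological_space measure \<Rightarrow> 'a set measure \<Rightarrow> bool" where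
  "poisson_random_measure \<sigma> P \<longleftrightarrow>
     prob_space P \<and> space P = configurations \<and> sets P = sets config_space \<and>
     (\<forall>A\<in>sets borel. emeasure \<sigma> A < \<infinity> \<longrightarrow>
        (\<forall>n::nat. measure P {\<omega> \<in> configurations. emeasure (config_measure \<omega>) A = of_nat n} =
           exp (- measure \<sigma> A) * measure \<sigma> A ^ n / fact n)) \<and>
     (\<forall>A\<in>sets borel. emeasure \<sigma> A = \<infinity> \<longrightarrow> (AE \<omega> in P. emeasure (config_measure \<omega>) A = \<infinity>)) \<and>
     (\<forall>(A :: nat \<Rightarrow> 'a set) m. (\<forall>i<m. A i \<in> sets borel) \<and> disjoint_family_on A {..<m} \<longrightarrow>
        prob_space.indep_vars P (\<lambda>_. borel) (\<lambda>i \<omega>. emeasure (config_measure \<omega>) (A i)) {..<m})"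

section \<open>Processes\<close>

text \<open>Vectors in the \<open>k\<close>-fold power are extensional functions on \<open>{1..k}\<close>.  The value type is left
  open: \<open>ereal\<close> gives processes with values in \<open>[-\<infinity>, \<infinity>]\<close>, and \<open>ennreal\<close> exactly the nonnegative ones.\<close>

definition process ::
  "nat \<Rightarrow> ((nat \<Rightarrow> 'a::topological_space) \<Rightarrow> 'a set \<Rightarrow> 'b::topological_space) \<Rightarrow> bool" where
  "process k f \<longleftrightarrow>
     (\<lambda>(x, \<omega>). f x \<omega>) \<in> borel_measurable ((\<Pi>\<^sub>M i\<in>{1..k}. borel) \<Otimes>\<^sub>M config_space)"

definition mixed_measure ::
  "'a::topological_space measure \<Rightarrow> 'a set \<Rightarrow> (nat \<Rightarrow> nat) \<Rightarrow> nat \<Rightarrow> (nat \<Rightarrow> 'a) measure" where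
  "mixed_measure \<sigma> \<omega> \<eta> r = (\<Pi>\<^sub>M i\<in>{1..r}. if \<eta> i = 1 then config_measure \<omega> else \<sigma>)"

definition distinct_tuples :: "nat \<Rightarrow> (nat \<Rightarrow> 'a) set" where
  "distinct_tuples k = {y \<in> {1..k} \<rightarrow>\<^sub>E UNIV. inj_on y {1..k}}"

section \<open>Partitions\<close>

definition index_set :: "nat \<Rightarrow> (nat \<Rightarrow> nat) \<Rightarrow> (nat \<Rightarrow> nat) \<Rightarrow> (nat \<times> nat \<times> nat) set" where
  "index_set l r n = {(\<alpha>, \<beta>, \<gamma>). \<alpha> \<in> {1..l} \<and> \<beta> \<in> {1..r \<alpha>} \<and> \<gamma> \<in> {1..n \<alpha>}}"

definition index_type :: "(nat \<Rightarrow> nat \<Rightarrow> nat) \<Rightarrow> nat \<times> nat \<times> nat \<Rightarrow> nat" where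
  "index_type \<epsilon> = (\<lambda>(\<alpha>, \<beta>, \<gamma>). \<epsilon> \<alpha> \<beta>)"

definition typed_partitions :: "'i set \<Rightarrow> ('i \<Rightarrow> nat) \<Rightarrow> 'i set set set" where
  "typed_partitions S \<epsilon> =
     {\<P>. partition_on S \<P> \<and> (\<forall>B\<in>\<P>. card B > 1 \<longrightarrow> (\<forall>s\<in>B. \<epsilon> s = 1))}"

text \<open>The vector \<open>y\<^sup>P\<close>, where \<open>b 1, \<dots>, b k\<close> enumerates the blocks of the partition \<open>P\<close>.\<close>

definition block_vector :: "nat \<Rightarrow> (nat \<Rightarrow> 'i set) \<Rightarrow> (nat \<Rightarrow> 'a) \<Rightarrow> 'i \<Rightarrow> 'a" where
  "block_vector k b y s = y (THE j. j \<in> {1..k} \<and> s \<in> b j)"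

definition added_config ::
  "'a set \<Rightarrow> 'i set \<Rightarrow> ('i \<Rightarrow> nat) \<Rightarrow> ('i \<Rightarrow> 'a) \<Rightarrow> 'a set" where
  "added_config \<omega> S \<epsilon> z = \<omega> \<union> (\<Union>s\<in>{s\<in>S. \<epsilon> s = 1}. {z s})"

end

theory Submission
  imports Defs
begin

text \<open>
The product of powers of integrals is, for a fixed configuration, a single integral over
\<open>X\<^sup>S\<close> against the product measure whose coordinate \<open>s\<close> carries either the configuration or the
intensity, according to the type of \<open>s\<close>. So the theorem is the case
\<open>F(z; \<omega>) = f\<^sub>0(\<omega>) \<Prod>\<^sub>\<alpha> \<Prod>\<^sub>\<gamma> f\<^sub>\<alpha>(z\<^sub>\<alpha>\<^sub>\<gamma>; \<omega>)\<close> of a formula for the expectation of one such mixed integral of an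
arbitrary measurable \<open>F\<close> (\<open>expectation_mixed_integral\<close>). That formula is proved by induction on \<open>S\<close>.

To add an index \<open>s\<close>, integrate out its coordinate first and apply the induction hypothesis to the
resulting function of \<open>(z, \<omega>)\<close>. In the term of a partition \<open>Q\<close> of \<open>S\<close>, this function is evaluated at
\<open>\<omega> \<union> Y\<close>, where \<open>Y\<close> consists of the points \<open>y\<^sub>B\<close> attached to the blocks of type 1. If \<open>s\<close> has type 1, the
inner integral is therefore a sum over the points of \<open>\<omega> \<union> Y\<close>, and since \<open>Y\<close> almost surely consists of
distinct points outside \<open>\<omega>\<close>, it splits. The points of \<open>Y\<close> contribute the partitions in which \<open>s\<close> joins an
existing block. The points of \<open>\<omega>\<close> contribute, by the Mecke equation
\<open>E \<integral> f(x; \<omega>) \<omega>(dx) = \<integral> E f(x; \<omega> \<union> {x}) \<sigma>(dx)\<close>, the partition in which \<open>s\<close> opens a new block, and its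
point is added to the configuration. If \<open>s\<close> has type 0, only Fubini is needed and \<open>s\<close> always opens a
new block. Every partition of \<open>S \<union> {s}\<close> arises exactly once in this way (\<open>sum_typed_partitions_insert\<close>).

The Mecke equation (\<open>mecke\<close>) has a short proof because the events \<open>{\<omega>. \<omega> \<inter> B = {}}\<close> are closed
under intersection and generate the \<open>\<sigma>\<close>-algebra of configurations (\<open>sets_config_space_void\<close>). It is
enough to test it on \<open>f(x; \<omega>) = 1\<^sub>A(x) 1(\<omega> \<inter> B = {})\<close>. There only the points of \<open>A - B\<close> count, so both
sides equal \<open>\<sigma>(A - B) P(\<omega> \<inter> B = {})\<close>; for the left side this uses the independence of the counts of the
two disjoint sets \<open>A - B\<close> and \<open>B\<close> and the mean of the count of \<open>A - B\<close>. The same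
generator makes the addition of points to a configuration visibly measurable, because
\<open>(\<omega> \<union> {x}) \<inter> B = {}\<close> means \<open>x \<notin> B\<close> and \<open>\<omega> \<inter> B = {}\<close>.
\<close>

section \<open>Configurations and events of empty sets\<close>

lemma configuration_Un_finite:
  assumes "\<omega> \<in> configurations" "finite Y"
  shows "\<omega> \<union> Y \<in> configurations"
  unfolding configurations_def locally_finite_set_def mem_Collect_eq
proof
  fix x
  obtain U where "open U" "x \<in> U" "finite (\<omega> \<inter> U)"
    using assms by (auto simp: configurations_def locally_finite_set_def)
  with assms(2) show "\<exists>U. open U \<and> x \<in> U \<and> finite ((\<omega> \<union> Y) \<inter> U)"
    by (intro exI[of _ U]) (auto simp: Int_Un_distrib2)
qed

lemma configuration_insert: "\<omega> \<in> configurations \<Longrightarrow> insert x \<omega> \<in> configurations"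
  using configuration_Un_finite[of \<omega> "{x}"] by simp

lemma finite_configuration_Int_compact:
  assumes "\<omega> \<in> configurations" "compact K"
  shows "finite (\<omega> \<inter> K)"
proof -
  have "\<forall>x. \<exists>U. open U \<and> x \<in> U \<and> finite (\<omega> \<inter> U)"
    using assms by (auto simp: configurations_def locally_finite_set_def)
  then obtain U where U: "\<And>x. open (U x)" "\<And>x. x \<in> U x" "\<And>x. finite (\<omega> \<inter> U x)"
    by metis
  obtain D where D: "D \<subseteq> K" "finite D" "K \<subseteq> (\<Union>x\<in>D. U x)"
    by (rule compactE_image[OF assms(2), of K U]) (use U in auto)
  have "\<omega> \<inter> K \<subseteq> (\<Union>x\<in>D. \<omega> \<inter> U x)"
    using D by auto
  moreover have "finite (\<Union>x\<in>D. \<omega> \<inter> U x)"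
    using D(2) U(3) by blast
  ultimately show ?thesis
    by (rule finite_subset)
qed

definition void_event :: "'a::topological_space set \<Rightarrow> 'a set set" where
  "void_event A = {\<omega> \<in> configurations. \<omega> \<inter> A = {}}"

lemma disjoint_neighbourhoods:
  fixes T :: "'a::metric_space set"
  assumes "finite T"
  obtains U where "\<And>t. t \<in> T \<Longrightarrow> open (U t)" "\<And>t. t \<in> T \<Longrightarrow> t \<in> U t"
    "disjoint_family_on U T"
proof -
  have "\<forall>a. \<exists>d>0. \<forall>x\<in>T. x \<noteq> a \<longrightarrow> d \<le> dist a x"
    using finite_set_avoid[OF assms] by blast
  then obtain d where d: "\<And>a. d a > 0" "\<And>a x. x \<in> T \<Longrightarrow> x \<noteq> a \<Longrightarrow> d a \<le> dist a x"
    by metis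
  show thesis
  proof
    show "disjoint_family_on (\<lambda>t. ball t (d t / 2)) T"
      unfolding disjoint_family_on_def
    proof (intro ballI impI)
      fix s t assume st: "s \<in> T" "t \<in> T" "s \<noteq> t"
      have "d s \<le> dist s t" "d t \<le> dist s t"
        using d(2)[of t s] d(2)[of s t] st by (auto simp: dist_commute)
      moreover have "dist s t < d s / 2 + d t / 2" if "x \<in> ball s (d s / 2)" "x \<in> ball t (d t / 2)" for x
        using dist_triangle2[of s t x] that by simp
      ultimately show "ball s (d s / 2) \<inter> ball t (d t / 2) = {}"
        by (fastforce simp: disjoint_iff simp del: mem_ball)
    qed
  qed (use d in auto)
qed

text \<open>One point of \<open>\<omega> \<inter> A\<close> can be chosen from each member of \<open>F\<close>, and disjointness makes the
choices different.\<close>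

lemma card_le_hitting_number:
  assumes F: "finite F" "disjoint F" "\<And>B. B \<in> F \<Longrightarrow> \<omega> \<inter> (A \<inter> B) \<noteq> {}"
  shows "of_nat (card F) \<le> emeasure (count_space UNIV) (\<omega> \<inter> A)"
proof (cases "finite (\<omega> \<inter> A)")
  case True
  define p where "p B = (SOME x. x \<in> \<omega> \<inter> (A \<inter> B))" for B
  have p: "p B \<in> \<omega> \<inter> (A \<inter> B)" if "B \<in> F" for B
    unfolding p_def by (rule someI_ex) (use F(3)[OF that] in auto)
  have "inj_on p F"
    using p F(2) by (intro inj_onI) (metis IntD2 disjointD disjoint_iff)
  then have "card F \<le> card (\<omega> \<inter> A)"
    using p by (intro card_inj_on_le[OF _ _ True]) auto
  with True show ?thesis by simp
qed simp

lemma ennreal_eq_infinity: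
  fixes x :: ennreal
  assumes "\<And>n. of_nat n \<le> x"
  shows "x = \<infinity>"
proof (rule ccontr)
  assume "x \<noteq> \<infinity>"
  then have "x < top" by (simp add: less_top)
  then obtain n where "x < of_nat n"
    using ennreal_Ex_less_of_nat by auto
  with assms[of n] show False by simp
qed

text \<open>The number of points in \<open>A\<close> is recovered from the knowledge of which sets \<open>A \<inter> B\<close> are hit, with
\<open>B\<close> from a countable basis: finitely many points can be separated by disjoint basis sets.\<close>

lemma count_eq_SUP_hitting:
  fixes \<omega> :: "'a::metric_space set"
  assumes B: "topological_basis \<B>"
  shows "emeasure (count_space UNIV) (\<omega> \<inter> A) =
    (SUP F\<in>{F. F \<subseteq> \<B> \<and> finite F \<and> disjoint F}.
       of_nat (card F) * indicator {\<omega>. \<forall>B\<in>F. \<omega> \<inter> (A \<inter> B) \<noteq> {}} \<omega>)" (is "_ = ?S")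
proof (rule antisym)
  have le: "of_nat (card T) \<le> ?S" if T: "finite T" "T \<subseteq> \<omega> \<inter> A" for T
  proof -
    obtain U where U: "\<And>t. t \<in> T \<Longrightarrow> open (U t)" "\<And>t. t \<in> T \<Longrightarrow> t \<in> U t" "disjoint_family_on U T"
      using disjoint_neighbourhoods[OF T(1)] by blast
    have "\<forall>t\<in>T. \<exists>V\<in>\<B>. t \<in> V \<and> V \<subseteq> U t"
      using U topological_basisE[OF B] by metis
    then obtain V where V: "\<And>t. t \<in> T \<Longrightarrow> V t \<in> \<B> \<and> t \<in> V t \<and> V t \<subseteq> U t"
      by metis
    have sep: "V s \<inter> V t = {}" if "s \<in> T" "t \<in> T" "s \<noteq> t" for s t
      using V[OF that(1)] V[OF that(2)] disjoint_family_onD[OF U(3) that] by blast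
    then have inj: "inj_on V T"
      using V by (intro inj_onI) (metis disjoint_iff)
    have dis: "disjoint (V ` T)"
      using sep by (intro disjointI) force
    have "\<forall>B\<in>V`T. \<omega> \<inter> (A \<inter> B) \<noteq> {}"
      using V T(2) by blast
    then have "of_nat (card T) =
        (of_nat (card (V ` T)) * indicator {\<omega>. \<forall>B\<in>V ` T. \<omega> \<inter> (A \<inter> B) \<noteq> {}} \<omega> :: ennreal)"
      by (simp add: card_image[OF inj])
    also have "\<dots> \<le> ?S"
      using V T(1) dis by (intro SUP_upper) auto
    finally show ?thesis .
  qed
  show "emeasure (count_space UNIV) (\<omega> \<inter> A) \<le> ?S"
  proof (cases "finite (\<omega> \<inter> A)")
    case False
    have "of_nat n \<le> ?S" for n
      using infinite_arbitrarily_large[OF False, of n] le by force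
    then have "?S = \<infinity>"
      by (rule ennreal_eq_infinity)
    then show ?thesis
      by (metis infinity_ennreal_def top_greatest)
  qed (use le in simp)
  show "?S \<le> emeasure (count_space UNIV) (\<omega> \<inter> A)"
    by (intro SUP_least) (auto simp: card_le_hitting_number split: split_indicator)
qed

lemma space_config_space: "space config_space = configurations"
  unfolding config_space_def by (rule space_measure_of) auto

lemma measurable_count:
  assumes "A \<in> sets borel"
  shows "(\<lambda>\<omega>. emeasure (config_measure \<omega>) A) \<in> borel_measurable config_space"
proof (rule measurableI)
  fix B :: "ennreal set" assume "B \<in> sets borel"
  with assms show "(\<lambda>\<omega>. emeasure (config_measure \<omega>) A) -` B \<inter> space config_space \<in> sets config_space"
    unfolding space_config_space
    by (auto simp: config_space_def vimage_def Int_def conj_commute intro!: in_measure_of)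
qed simp

text \<open>Counts are suprema of countably many functions of events of empty sets (\<open>count_eq_SUP_hitting\<close>), so
these events generate the same \<open>\<sigma>\<close>-algebra as the counts. They form a \<open>\<pi>\<close>-system, as
\<open>\<omega> \<inter> A = {}\<close> and \<open>\<omega> \<inter> B = {}\<close> together say \<open>\<omega> \<inter> (A \<union> B) = {}\<close>.\<close>

lemma sets_config_space_void:
  "sets (config_space :: 'a::{metric_space,second_countable_topology} set measure) =
     sigma_sets configurations (void_event ` sets borel)"
proof
  let ?V = "sigma configurations (void_event ` sets (borel :: 'a measure))"
  have sp: "space ?V = configurations" and
    se: "sets ?V = sigma_sets configurations (void_event ` sets (borel :: 'a measure))"
    by (auto simp: void_event_def intro!: space_measure_of sets_measure_of)
  obtain \<B> :: "'a set set" where B: "countable \<B>" "topological_basis \<B>"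
    using ex_countable_basis by blast
  have 1: "(\<lambda>\<omega>. emeasure (config_measure \<omega>) A) \<in> borel_measurable ?V" if A: "A \<in> sets borel" for A :: "'a set"
  proof -
    let ?F = "{F. F \<subseteq> \<B> \<and> finite F \<and> disjoint F}"
    have "countable ?F"
      by (rule countable_subset[OF _ countable_Collect_finite_subset[OF B(1)]]) auto
    have m: "(\<lambda>\<omega>. of_nat (card F) * indicator {\<omega>. \<forall>B\<in>F. \<omega> \<inter> (A \<inter> B) \<noteq> {}} \<omega> :: ennreal) \<in> borel_measurable ?V"
      if F: "F \<in> ?F" for F
    proof -
      have "{\<omega> \<in> space ?V. \<omega> \<inter> (A \<inter> B) \<noteq> {}} \<in> sets ?V" if "B \<in> F" for B
      proof -
        have "open B" using F that B(2) topological_basis_open by blast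
        then have "void_event (A \<inter> B) \<in> sets ?V"
          unfolding se using A by (intro sigma_sets.Basic) auto
        then have "space ?V - void_event (A \<inter> B) \<in> sets ?V" by (rule sets.compl_sets)
        also have "space ?V - void_event (A \<inter> B) = {\<omega> \<in> space ?V. \<omega> \<inter> (A \<inter> B) \<noteq> {}}"
          unfolding sp by (auto simp: void_event_def)
        finally show ?thesis .
      qed
      then have "Measurable.pred ?V (\<lambda>\<omega>. \<forall>B\<in>F. \<omega> \<inter> (A \<inter> B) \<noteq> {})"
        using F by (intro pred_intros_finite) (auto simp: pred_def)
      then show ?thesis by measurable
    qed
    have *: "(\<lambda>\<omega>. emeasure (config_measure \<omega>) A) = (\<lambda>\<omega>. (SUP F\<in>?F.
       of_nat (card F) * indicator {\<omega>. \<forall>B\<in>F. \<omega> \<inter> (A \<inter> B) \<noteq> {}} \<omega>))"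
      using A by (simp add: emeasure_config_measure count_eq_SUP_hitting[OF B(2)])
    show ?thesis
      unfolding * by (intro borel_measurable_SUP \<open>countable ?F\<close> m)
  qed
  have "{\<omega> \<in> configurations. emeasure (config_measure \<omega>) A \<in> B} \<in> sets ?V"
    if "A \<in> sets borel" "B \<in> sets borel" for A :: "'a set" and B
    using measurable_sets[OF 1[OF that(1)] that(2)]
    unfolding sp by (simp add: vimage_def Int_def conj_commute)
  then show "sets (config_space :: 'a set measure) \<subseteq> sigma_sets configurations (void_event ` sets borel)"
    unfolding config_space_def se[symmetric]
    by (subst sets_measure_of, force, subst sp[symmetric], intro sets.sigma_sets_subset) auto
next
  have "void_event A \<in> sets config_space" if A: "A \<in> sets borel" for A :: "'a set"
  proof -
    have "emeasure (config_measure \<omega>) A = 0 \<longleftrightarrow> \<omega> \<inter> A = {}" for \<omega>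
      using A by (simp add: emeasure_config_measure emeasure_count_space_eq_0)
    then have "void_event A = (\<lambda>\<omega>. emeasure (config_measure \<omega>) A) -` {0} \<inter> space config_space"
      by (auto simp: void_event_def space_config_space)
    then show ?thesis
      using measurable_sets[OF measurable_count[OF A], of "{0}"] by simp
  qed
  then show "sigma_sets configurations (void_event ` sets borel) \<subseteq> sets (config_space :: 'a set measure)"
    by (subst space_config_space[symmetric], intro sets.sigma_sets_subset) auto
qed

lemma void_event_sets: 
  fixes A :: "'a::{metric_space,second_countable_topology} set"
  shows "A \<in> sets borel \<Longrightarrow> void_event A \<in> sets config_space"
  by (auto simp: sets_config_space_void)

text \<open>It suffices to test the events of empty sets, and the enlarged configuration misses \<open>A\<close> exactly
when \<open>w a\<close> and all the added points do. A test on counts would have to know whether an added point already belongs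
to \<open>w a\<close>.\<close>

lemma measurable_Un_points:
  fixes w :: "'b \<Rightarrow> 'a::{metric_space,second_countable_topology} set"
  assumes w[measurable]: "w \<in> measurable N config_space"
    and "finite T" and [measurable]: "\<And>t. t \<in> T \<Longrightarrow> p t \<in> borel_measurable N"
  shows "(\<lambda>a. w a \<union> (\<lambda>t. p t a) ` T) \<in> measurable N config_space"
proof (rule measurable_sigma_sets[OF sets_config_space_void])
  show "(\<lambda>a. w a \<union> (\<lambda>t. p t a) ` T) \<in> space N \<rightarrow> configurations"
    using measurable_space[OF w] \<open>finite T\<close>
    by (auto simp: space_config_space intro!: configuration_Un_finite)
  fix V assume "V \<in> void_event ` sets (borel :: 'a measure)"
  then obtain A where A[measurable]: "A \<in> sets borel" and V: "V = void_event A" by auto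
  have [measurable]: "void_event A \<in> sets config_space"
    by (rule void_event_sets) fact
  have "(\<lambda>a. w a \<union> (\<lambda>t. p t a) ` T) -` V \<inter> space N =
      {a \<in> space N. w a \<in> void_event A \<and> (\<forall>t\<in>T. p t a \<notin> A)}"
    using measurable_space[OF w] \<open>finite T\<close>
    by (auto simp: V void_event_def space_config_space intro!: configuration_Un_finite)
  also have "\<dots> \<in> sets N"
    using \<open>finite T\<close> by measurable
  finally show "(\<lambda>a. w a \<union> (\<lambda>t. p t a) ` T) -` V \<inter> space N \<in> sets N" .
qed (auto simp: void_event_def)

lemma nn_integral_config_measure:
  assumes "f \<in> borel_measurable borel"
  shows "(\<integral>\<^sup>+x. f x \<partial>config_measure \<omega>) = (\<integral>\<^sup>+x. f x \<partial>count_space \<omega>)"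
  unfolding config_measure_def using assms by (intro nn_integral_distr) auto

lemma nn_integral_config_measure_Un:
  assumes [measurable]: "f \<in> borel_measurable borel" and "finite Y" "\<omega> \<inter> Y = {}"
  shows "(\<integral>\<^sup>+x. f x \<partial>config_measure (\<omega> \<union> Y)) = (\<integral>\<^sup>+x. f x \<partial>config_measure \<omega>) + (\<Sum>x\<in>Y. f x)"
proof -
  have "(\<integral>\<^sup>+x. f x \<partial>count_space (\<omega> \<union> Y)) = (\<integral>\<^sup>+x. f x \<partial>count_space \<omega>) + (\<integral>\<^sup>+x. f x \<partial>count_space Y)"
    using nn_integral_disjoint_pair_countspace[OF assms(3), of f]
    by (simp add: nn_integral_restrict_space[symmetric] restrict_count_space)
  then show ?thesis
    using assms by (simp add: nn_integral_config_measure nn_integral_count_space_finite)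
qed

section \<open>Integration against a configuration\<close>

text \<open>By the Lindelof property, countably many relatively compact open sets cover the space; they are then
made disjoint. On each piece both the
intensity and every configuration are finite, which is what reduces statements about these \<open>\<sigma>\<close>-finite
measures to finite ones.\<close>

lemma countable_compact_window_partition:
  assumes lc: "locally_compact_space (euclidean :: 'a::{metric_space,second_countable_topology} topology)"
  obtains A :: "nat \<Rightarrow> 'a::{metric_space,second_countable_topology} set"
  where "\<And>n. A n \<in> sets borel" "disjoint_family A" "(\<Union>n. A n) = UNIV" "\<And>n. \<exists>K. compact K \<and> A n \<subseteq> K"
proof -
  have ex: "\<exists>U K. open U \<and> compact K \<and> x \<in> U \<and> U \<subseteq> K" for x :: 'a
    using lc by (simp add: locally_compact_space_def)
  let ?U = "{U :: 'a set. open U \<and> (\<exists>K. compact K \<and> U \<subseteq> K)}"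
  obtain F where F: "F \<subseteq> ?U" "countable F" "\<Union>F = \<Union>?U"
    by (rule Lindelof[of ?U]) auto
  have cov: "\<Union>F = UNIV"
    unfolding F(3) using ex by blast
  then have ne: "F \<noteq> {}" by auto
  let ?A = "from_nat_into F"
  have A: "?A n \<in> ?U" for n
    using from_nat_into[OF ne, of n] F(1) by blast
  show thesis
  proof
    show "disjointed ?A n \<in> sets borel" for n
      using A unfolding disjointed_def by auto
    show "(\<Union>n. disjointed ?A n) = UNIV"
      using cov range_from_nat_into[OF ne F(2)] by (simp add: UN_disjointed_eq)
    show "\<exists>K. compact K \<and> disjointed ?A n \<subseteq> K" for n
      using A[of n] disjointed_subset[of ?A n] by blast
  qed (rule disjoint_family_disjointed)
qed

lemma nn_integral_countable_partition:
  fixes A :: "nat \<Rightarrow> 'a set"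
  assumes [measurable]: "f \<in> borel_measurable M" "\<And>n. A n \<in> sets M"
    and "disjoint_family A" "space M \<subseteq> (\<Union>n. A n)"
  shows "(\<integral>\<^sup>+x. f x \<partial>M) = (\<Sum>n. \<integral>\<^sup>+x. indicator (A n) x * f x \<partial>M)"
proof -
  have "(\<integral>\<^sup>+x. f x \<partial>M) = (\<integral>\<^sup>+x. (\<Sum>n. indicator (A n) x * f x) \<partial>M)"
    using assms(4) by (intro nn_integral_cong)
      (auto simp: suminf_indicator[OF assms(3)] split: split_indicator)
  also have "\<dots> = (\<Sum>n. \<integral>\<^sup>+x. indicator (A n) x * f x \<partial>M)"
    by (rule nn_integral_suminf) measurable
  finally show ?thesis .
qed

lemma space_config_measure [simp]: "space (config_measure \<omega>) = UNIV"
  by (simp add: config_measure_def)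

lemma sets_config_measure [simp, measurable_cong]: "sets (config_measure \<omega>) = sets borel"
  by (simp add: config_measure_def)

lemma emeasure_config_measure_finite:
  assumes "\<omega> \<in> configurations" "A \<in> sets borel" "compact K" "A \<subseteq> K"
  shows "emeasure (config_measure \<omega>) A < \<infinity>"
proof -
  have "finite (\<omega> \<inter> A)"
    by (rule finite_subset[OF _ finite_configuration_Int_compact[OF assms(1,3)]]) (use assms in auto)
  with assms(2) show ?thesis
    by (simp add: emeasure_config_measure of_nat_less_top)
qed

lemma sigma_finite_if_finite_on_compacts:
  fixes M :: "'a::{metric_space,second_countable_topology} measure"
  assumes lc: "locally_compact_space (euclidean :: 'a topology)" and M: "sets M = sets borel"
    and fin: "\<And>A K. A \<in> sets borel \<Longrightarrow> compact K \<Longrightarrow> A \<subseteq> K \<Longrightarrow> emeasure M A < \<infinity>"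
  shows "sigma_finite_measure M"
proof -
  obtain A :: "nat \<Rightarrow> 'a set" where A: "\<And>n. A n \<in> sets borel" "(\<Union>n. A n) = UNIV"
      "\<And>n. \<exists>K. compact K \<and> A n \<subseteq> K"
    using countable_compact_window_partition[OF lc] by metis
  have "\<And>n. emeasure M (A n) < \<infinity>"
    using A fin by metis
  then show ?thesis
    by (intro sigma_finite_measure.intro exI[of _ "range A"])
      (use A M sets_eq_imp_space_eq[OF M] in \<open>auto simp: less_top\<close>)
qed

lemma sigma_finite_config_measure:
  assumes "locally_compact_space (euclidean :: 'a::{metric_space,second_countable_topology} topology)"
    and "\<omega> \<in> configurations"
  shows "sigma_finite_measure (config_measure (\<omega> :: 'a::{metric_space,second_countable_topology} set))"
  using assms by (intro sigma_finite_if_finite_on_compacts emeasure_config_measure_finite) auto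

text \<open>Joint measurability of \<open>f\<close> is known to be preserved by integration against a kernel of
subprobability measures. Restricted to a piece \<open>A n\<close> of the partition and divided by its finite total
mass, a configuration becomes such a kernel, and the integral is the sum over the pieces of mass times
normalised integral.\<close>

lemma measurable_nn_integral_config_measure:
  fixes w :: "'b \<Rightarrow> 'a::{metric_space,second_countable_topology} set"
  assumes lc: "locally_compact_space (euclidean :: 'a topology)"
    and w[measurable]: "w \<in> measurable N config_space"
    and f[measurable]: "(\<lambda>(a, x). f a x) \<in> borel_measurable (N \<Otimes>\<^sub>M borel)"
  shows "(\<lambda>a. \<integral>\<^sup>+x. f a x \<partial>config_measure (w a)) \<in> borel_measurable N"
proof -
  obtain A :: "nat \<Rightarrow> 'a set" where A[measurable]: "\<And>n. A n \<in> sets borel" and A': "disjoint_family A"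
      "(\<Union>n. A n) = UNIV" "\<And>n. \<exists>K. compact K \<and> A n \<subseteq> K"
    using countable_compact_window_partition[OF lc] by metis
  have w_conf: "w a \<in> configurations" if "a \<in> space N" for a
    using measurable_space[OF w that] by (simp add: space_config_space)
  have count[measurable]: "(\<lambda>a. emeasure (config_measure (w a)) B) \<in> borel_measurable N"
    if "B \<in> sets borel" for B
    using measurable_compose[OF w measurable_count[OF that]] .
  have "(\<lambda>a. \<integral>\<^sup>+x. indicator (A n) x * f a x \<partial>config_measure (w a)) \<in> borel_measurable N" for n
  proof -
    define c where "c a = emeasure (config_measure (w a)) (A n)" for a
    have c[measurable]: "c \<in> borel_measurable N"
      unfolding c_def by measurable
    have fin: "c a < \<infinity>" if "a \<in> space N" for a
      unfolding c_def using A' emeasure_config_measure_finite[OF w_conf[OF that] A] by metis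
    define L where "L a = density (config_measure (w a)) (\<lambda>x. indicator (A n) x / c a)" for a
    have eL: "emeasure (L a) B = emeasure (config_measure (w a)) (A n \<inter> B) / c a" if [measurable]: "B \<in> sets borel" for a B
    proof -
      have "emeasure (L a) B = (\<integral>\<^sup>+x. indicator (A n \<inter> B) x / c a \<partial>config_measure (w a))"
        unfolding L_def by (subst emeasure_density) (auto intro!: nn_integral_cong split: split_indicator)
      then show ?thesis by (simp add: nn_integral_divide)
    qed
    have sL: "sets (L a) = sets borel" for a by (simp add: L_def)
    have L: "L \<in> measurable N (subprob_algebra borel)"
    proof (rule measurable_subprob_algebra)
      fix a assume "a \<in> space N"
      have "emeasure (L a) (space (L a)) = c a / c a"
        unfolding L_def[THEN arg_cong, of space] by (simp add: eL c_def)
      also have "\<dots> \<le> 1"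
        using fin[OF \<open>a \<in> space N\<close>] by (cases "c a = 0") (auto simp: ennreal_divide_self less_top)
      finally show "subprob_space (L a)"
        by (intro subprob_spaceI) (auto simp: L_def)
    qed (use sL in \<open>auto simp: eL\<close>)
    have "(\<integral>\<^sup>+x. indicator (A n) x * f a x \<partial>config_measure (w a)) = c a * (\<integral>\<^sup>+x. f a x \<partial>L a)"
      if a: "a \<in> space N" for a
    proof (cases "c a = 0")
      case True
      then have "AE x in config_measure (w a). x \<notin> A n"
        by (intro AE_I[of _ _ "A n"]) (auto simp: c_def)
      then have "(\<integral>\<^sup>+x. indicator (A n) x * f a x \<partial>config_measure (w a)) = (\<integral>\<^sup>+x. 0 \<partial>config_measure (w a))"
        by (intro nn_integral_cong_AE) auto
      with True show ?thesis by simp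
    next
      case False
      have [measurable]: "f a \<in> borel_measurable borel"
        using measurable_compose[OF measurable_Pair1'[OF a] f] by simp
      have cc: "c a * (1 / c a) = 1"
        using False fin[OF a] by (simp add: ennreal_times_divide ennreal_divide_self less_top)
      have "c a * (\<integral>\<^sup>+x. f a x \<partial>L a) = (\<integral>\<^sup>+x. c a * (indicator (A n) x / c a * f a x) \<partial>config_measure (w a))"
        unfolding L_def by (subst nn_integral_density) (auto simp: nn_integral_cmult)
      also have "\<dots> = (\<integral>\<^sup>+x. indicator (A n) x * f a x \<partial>config_measure (w a))"
        using cc by (intro nn_integral_cong) (auto simp: mult.assoc[symmetric] split: split_indicator)
      finally show ?thesis ..
    qed
    moreover have "(\<lambda>a. c a * (\<integral>\<^sup>+x. f a x \<partial>L a)) \<in> borel_measurable N"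
      using nn_integral_measurable_subprob_algebra2[OF f L] by measurable
    ultimately show ?thesis
      by (simp cong: measurable_cong)
  qed
  then have "(\<lambda>a. \<Sum>n. \<integral>\<^sup>+x. indicator (A n) x * f a x \<partial>config_measure (w a)) \<in> borel_measurable N"
    by measurable
  also have "?this \<longleftrightarrow> ?thesis"
  proof (rule measurable_cong)
    fix a assume a: "a \<in> space N"
    have [measurable]: "f a \<in> borel_measurable borel"
      using measurable_compose[OF measurable_Pair1'[OF a] f] by simp
    show "(\<Sum>n. \<integral>\<^sup>+x. indicator (A n) x * f a x \<partial>config_measure (w a)) = (\<integral>\<^sup>+x. f a x \<partial>config_measure (w a))"
      using A' by (intro nn_integral_countable_partition[symmetric]) auto
  qed
  finally show ?thesis .
qed

section \<open>The Mecke equation\<close>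

locale poisson_process =
  fixes \<sigma> :: "'a::{metric_space, second_countable_topology} measure"
    and P :: "'a set measure"
  assumes locally_compact: "locally_compact_space (euclidean :: 'a topology)"
    and sets_intensity [measurable_cong, simp]: "sets \<sigma> = sets borel"
    and non_atomic: "non_atomic \<sigma>"
    and intensity_finite_compact: "\<And>K. compact K \<Longrightarrow> emeasure \<sigma> K < \<infinity>"
    and poisson: "poisson_random_measure \<sigma> P"
begin

sublocale P: prob_space P
  using poisson by (simp add: poisson_random_measure_def)

lemma space_P [simp]: "space P = configurations"
  using poisson by (simp add: poisson_random_measure_def)

lemma sets_P [measurable_cong, simp]: "sets P = sets config_space"
  using poisson by (simp add: poisson_random_measure_def)

lemma space_intensity [simp]: "space \<sigma> = UNIV"
  using sets_eq_imp_space_eq[OF sets_intensity] by simp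

lemma intensity_finite:
  assumes "compact K" "A \<subseteq> K" 
  shows "emeasure \<sigma> A < \<infinity>"
  using emeasure_mono[OF assms(2), of \<sigma>] intensity_finite_compact[OF assms(1)] assms(1)
  by (auto intro: le_less_trans borel_compact)

sublocale S: sigma_finite_measure \<sigma>
  using intensity_finite by (intro sigma_finite_if_finite_on_compacts locally_compact) auto

sublocale PS: pair_sigma_finite P \<sigma> ..

lemma expected_count:
  assumes A[measurable]: "A \<in> sets borel" and fin: "emeasure \<sigma> A < \<infinity>"
  shows "(\<integral>\<^sup>+\<omega>. emeasure (config_measure \<omega>) A \<partial>P) = emeasure \<sigma> A"
proof -
  define X where "X \<omega> = emeasure (config_measure \<omega>) A" for \<omega>
  define m where "m = measure \<sigma> A"
  have m: "emeasure \<sigma> A = ennreal m" "m \<ge> 0"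
    using fin by (auto simp: m_def emeasure_eq_ennreal_measure less_top)
  have [measurable]: "X \<in> borel_measurable P"
    unfolding X_def using measurable_count[OF A] by simp
  define E where "E n = {\<omega> \<in> configurations. X \<omega> = of_nat n}" for n
  have E_sets[measurable]: "E n \<in> sets P" for n
  proof -
    have "E n = X -` {of_nat n} \<inter> space P" by (auto simp: E_def)
    also have "\<dots> \<in> sets P" by (rule measurable_sets[where A=borel]) auto
    finally show ?thesis .
  qed
  have prob: "measure P (E n) = exp (- m) * m ^ n / fact n" for n
    using poisson fin A unfolding poisson_random_measure_def E_def X_def m_def by auto
  have disj: "disjoint_family E"
    by (auto simp: disjoint_family_on_def E_def)
  have "(\<lambda>n. exp (- m) * (m ^ n / fact n)) sums (exp (- m) * exp m)"
    using exp_converges[of m] by (intro sums_mult) (simp add: field_simps)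
  then have "(\<lambda>n. measure P (E n)) sums 1"
    by (simp add: prob exp_minus field_simps)
  moreover have "(\<lambda>n. measure P (E n)) sums measure P (\<Union>n. E n)"
    by (rule P.finite_measure_UNION[OF _ disj]) (unfold image_subset_iff, intro ballI E_sets)
  ultimately have "measure P (\<Union>n. E n) = 1"
    using sums_unique2 by blast
  then have AE: "AE \<omega> in P. \<omega> \<in> (\<Union>n. E n)"
    by (intro P.AE_prob_1) 
  have "(\<integral>\<^sup>+\<omega>. X \<omega> \<partial>P) = (\<integral>\<^sup>+\<omega>. (\<Sum>n. of_nat n * indicator (E n) \<omega>) \<partial>P)"
  proof (intro nn_integral_cong_AE)
    show "AE \<omega> in P. X \<omega> = (\<Sum>n. of_nat n * indicator (E n) \<omega>)"
      using AE
    proof eventually_elim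
      case (elim \<omega>)
      then obtain k where k: "\<omega> \<in> E k" by blast
      then have "n \<noteq> k \<Longrightarrow> \<omega> \<notin> E n" for n
        using disj by (auto simp: disjoint_family_on_def)
      then have "(\<Sum>n. of_nat n * indicator (E n) \<omega> :: ennreal) = (\<Sum>n\<in>{k}. of_nat n * indicator (E n) \<omega>)"
        by (intro suminf_finite) auto
      also have "\<dots> = X \<omega>" using k by (simp add: E_def)
      finally show ?case ..
    qed
  qed
  also have "\<dots> = (\<Sum>n. of_nat n * emeasure P (E n))"
    using E_sets by (simp add: nn_integral_suminf nn_integral_cmult)
  also have "\<dots> = (\<Sum>n. ennreal (real n * (exp (- m) * m ^ n / fact n)))"
    using m by (intro arg_cong[where f=suminf] ext)
      (simp add: P.emeasure_eq_measure prob ennreal_of_nat_eq_real_of_nat flip: ennreal_mult)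
  also have "\<dots> = ennreal m"
  proof (rule suminf_ennreal_eq)
    have "(\<lambda>n. exp (- m) * m * (m ^ n / fact n)) sums (exp (- m) * m * exp m)"
      using exp_converges[of m] by (intro sums_mult) (simp add: field_simps)
    then have "(\<lambda>n. exp (- m) * m * (m ^ n / fact n)) sums m"
      by (simp add: exp_minus field_simps)
    also have "(\<lambda>n. exp (- m) * m * (m ^ n / fact n)) = (\<lambda>n. real (Suc n) * (exp (- m) * m ^ (Suc n) / fact (Suc n)))"
      by (auto simp: fun_eq_iff divide_simps simp del: of_nat_Suc)
    finally show "(\<lambda>n. real n * (exp (- m) * m ^ n / fact n)) sums m"
      by (subst (asm) sums_Suc_iff) simp
  qed (use m in auto)
  finally show ?thesis by (simp add: X_def m)
qed

text \<open>Here \<open>void_event B\<close> is the event that the count of \<open>B\<close> vanishes, hence independent of the count of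
the disjoint set \<open>A\<close>.\<close>

lemma expected_count_void_event:
  assumes [measurable]: "A \<in> sets borel" "B \<in> sets borel" and disj: "A \<inter> B = {}" and fin: "emeasure \<sigma> A < \<infinity>"
  shows "(\<integral>\<^sup>+\<omega>. emeasure (config_measure \<omega>) A * indicator (void_event B) \<omega> \<partial>P) =
    emeasure \<sigma> A * emeasure P (void_event B)"
proof -
  let ?C = "\<lambda>i::nat. if i = 0 then A else B"
  let ?X = "\<lambda>i \<omega>. emeasure (config_measure \<omega>) (?C i)"
  let ?Y = "\<lambda>i::nat. if i = 0 then (\<lambda>x. x) else indicator {0::ennreal}"
  have "P.indep_vars (\<lambda>_. borel) ?X {..<2}"
    using poisson disj unfolding poisson_random_measure_def
    by (elim conjE allE[of _ ?C] allE[of _ 2]) (use disj in \<open>auto simp: disjoint_family_on_def less_2_cases_iff disjoint_iff\<close>)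
  then have "P.indep_vars (\<lambda>_. borel) (\<lambda>i \<omega>. ?Y i (?X i \<omega>)) {..<2}"
    by (rule P.indep_vars_compose2) auto
  then have *: "(\<integral>\<^sup>+\<omega>. (\<Prod>i<2. ?Y i (?X i \<omega>)) \<partial>P) = (\<Prod>i<2. \<integral>\<^sup>+\<omega>. ?Y i (?X i \<omega>) \<partial>P)"
    by (intro P.indep_vars_nn_integral) auto
  have ind: "indicator {0} (emeasure (config_measure \<omega>) B) = (indicator (void_event B) \<omega> :: ennreal)"
    if "\<omega> \<in> configurations" for \<omega>
    using that by (auto simp: emeasure_config_measure void_event_def emeasure_count_space_eq_0 split: split_indicator)
  have V: "void_event B \<in> sets P"
    by (simp add: void_event_sets)
  have "(\<integral>\<^sup>+\<omega>. emeasure (config_measure \<omega>) A * indicator (void_event B) \<omega> \<partial>P) =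
     (\<integral>\<^sup>+\<omega>. (\<Prod>i<2. ?Y i (?X i \<omega>)) \<partial>P)"
    by (intro nn_integral_cong) (simp add: ind numeral_2_eq_2)
  also have "\<dots> = emeasure \<sigma> A * (\<integral>\<^sup>+\<omega>. indicator {0} (emeasure (config_measure \<omega>) B) \<partial>P)"
    unfolding * by (simp add: expected_count[OF assms(1) fin] numeral_2_eq_2)
  also have "(\<integral>\<^sup>+\<omega>. indicator {0} (emeasure (config_measure \<omega>) B) \<partial>P) = (\<integral>\<^sup>+\<omega>. indicator (void_event B) \<omega> \<partial>P)"
    by (intro nn_integral_cong) (simp add: ind)
  finally show ?thesis using V by simp
qed

text \<open>On \<open>void_event B\<close> the configuration has the same number of points in \<open>W \<inter> A\<close> as in \<open>W \<inter> A - B\<close>;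
on the other side, \<open>insert x \<omega>\<close> misses \<open>B\<close> only if \<open>x\<close> does. Both sides are
\<open>\<sigma>(W \<inter> A - B) P(void_event B)\<close>.\<close>

lemma mecke_window_rectangle:
  assumes [measurable]: "W \<in> sets borel" "A \<in> sets borel" "B \<in> sets borel" and W: "emeasure \<sigma> W < \<infinity>"
  shows "(\<integral>\<^sup>+\<omega>. \<integral>\<^sup>+x. indicator W x * indicator (A \<times> void_event B) (x, \<omega>) \<partial>config_measure \<omega> \<partial>P) =
    (\<integral>\<^sup>+x. \<integral>\<^sup>+\<omega>. indicator W x * indicator (A \<times> void_event B) (x, insert x \<omega>) \<partial>P \<partial>\<sigma>)"
proof -
  let ?D = "W \<inter> A - B"
  have D: "emeasure \<sigma> ?D < \<infinity>"
    using W by (rule le_less_trans[rotated]) (auto intro: emeasure_mono)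
  have "(\<integral>\<^sup>+x. indicator W x * indicator (A \<times> void_event B) (x, \<omega>) \<partial>config_measure \<omega>) =
    emeasure (config_measure \<omega>) ?D * indicator (void_event B) \<omega>" for \<omega>
  proof (cases "\<omega> \<in> void_event B")
    case True
    then have "(\<integral>\<^sup>+x. indicator W x * indicator (A \<times> void_event B) (x, \<omega>) \<partial>config_measure \<omega>) =
      (\<integral>\<^sup>+x. indicator (W \<inter> A) x \<partial>config_measure \<omega>)"
      by (intro nn_integral_cong) (auto split: split_indicator)
    also have "\<dots> = emeasure (config_measure \<omega>) (W \<inter> A)"
      by simp
    also have "\<dots> = emeasure (config_measure \<omega>) ?D"
    proof -
      have "\<omega> \<inter> (W \<inter> A) = \<omega> \<inter> ?D"
        using True by (auto simp: void_event_def)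
      then show ?thesis by (simp add: emeasure_config_measure)
    qed
    finally show ?thesis using True by simp
  qed (simp add: indicator_times)
  then have "(\<integral>\<^sup>+\<omega>. \<integral>\<^sup>+x. indicator W x * indicator (A \<times> void_event B) (x, \<omega>) \<partial>config_measure \<omega> \<partial>P) =
      emeasure \<sigma> ?D * emeasure P (void_event B)"
    using D by (simp add: expected_count_void_event Diff_Int_distrib2)
  also have "\<dots> = (\<integral>\<^sup>+x. \<integral>\<^sup>+\<omega>. indicator ?D x * indicator (void_event B) \<omega> \<partial>P \<partial>\<sigma>)"
  proof -
    have "(\<integral>\<^sup>+\<omega>. indicator ?D x * indicator (void_event B) \<omega> \<partial>P) = indicator ?D x * emeasure P (void_event B)" for x
      using void_event_sets[OF assms(3)] by (intro nn_integral_cmult_indicator) simp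
    then show ?thesis by (simp add: nn_integral_multc)
  qed
  also have "\<dots> = (\<integral>\<^sup>+x. \<integral>\<^sup>+\<omega>. indicator W x * indicator (A \<times> void_event B) (x, insert x \<omega>) \<partial>P \<partial>\<sigma>)"
    by (intro nn_integral_cong) (auto simp: void_event_def configuration_insert split: split_indicator)
  finally show ?thesis .
qed

lemma measurable_insert_point:
  "(\<lambda>(x, \<omega>). insert x \<omega>) \<in> measurable (borel \<Otimes>\<^sub>M config_space) (config_space :: 'a set measure)"
  using measurable_Un_points[of snd "borel \<Otimes>\<^sub>M (config_space :: 'a set measure)" "{()}" "\<lambda>_. fst"]
  by (simp add: case_prod_beta')

text \<open>As functions of \<open>f\<close> both sides are integrals against measures, which are
finite because of the window \<open>W\<close> and agree on a generating
\<open>\<pi>\<close>-system of rectangles. They are therefore equal on all measurable sets, and then on all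
nonnegative measurable functions.\<close>

lemma mecke_window:
  assumes [measurable]: "W \<in> sets borel" and W: "emeasure \<sigma> W < \<infinity>"
    and f: "f \<in> borel_measurable (borel \<Otimes>\<^sub>M config_space)"
  shows "(\<integral>\<^sup>+\<omega>. \<integral>\<^sup>+x. indicator W x * f (x, \<omega>) \<partial>config_measure \<omega> \<partial>P) =
    (\<integral>\<^sup>+x. \<integral>\<^sup>+\<omega>. indicator W x * f (x, insert x \<omega>) \<partial>P \<partial>\<sigma>)"
proof -
  let ?M = "borel \<Otimes>\<^sub>M config_space :: ('a \<times> 'a set) measure"
  define F where "F f = (\<integral>\<^sup>+\<omega>. \<integral>\<^sup>+x. indicator W x * f (x, \<omega>) \<partial>config_measure \<omega> \<partial>P)" for f
  define G where "G f = (\<integral>\<^sup>+x. \<integral>\<^sup>+\<omega>. indicator W x * f (x, insert x \<omega>) \<partial>P \<partial>\<sigma>)" for f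
  have sp: "space ?M = UNIV \<times> configurations"
    by (simp add: space_pair_measure space_config_space)
  have F1: "(\<lambda>x. g (x, \<omega>)) \<in> borel_measurable borel" if "\<omega> \<in> configurations" and g: "g \<in> borel_measurable ?M" for g :: "_ \<Rightarrow> ennreal" and \<omega>
    using measurable_compose[OF measurable_Pair2'[of \<omega> config_space borel] g] that by (simp add: space_config_space)
  have F2: "(\<lambda>\<omega>. \<integral>\<^sup>+x. indicator W x * g (x, \<omega>) \<partial>config_measure \<omega>) \<in> borel_measurable P"
    if [measurable]: "g \<in> borel_measurable ?M" for g :: "_ \<Rightarrow> ennreal"
    by (rule measurable_nn_integral_config_measure[OF locally_compact]) measurable
  have G0: "(\<lambda>(x, \<omega>). (x, insert x \<omega>)) \<in> measurable ?M ?M"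
    unfolding case_prod_beta'
    by (intro measurable_Pair measurable_fst measurable_insert_point[unfolded case_prod_beta'])
  have G1[measurable]: "(\<lambda>(x, \<omega>). g (x, insert x \<omega>)) \<in> borel_measurable (borel \<Otimes>\<^sub>M P)" if g: "g \<in> borel_measurable ?M" for g :: "_ \<Rightarrow> ennreal"
    using measurable_compose[OF G0 g] by (simp add: case_prod_beta' cong: measurable_cong_sets)
  have G2[measurable]: "(\<lambda>\<omega>. g (x, insert x \<omega>)) \<in> borel_measurable P" if g: "g \<in> borel_measurable ?M" for g :: "_ \<Rightarrow> ennreal" and x
    using measurable_compose[OF measurable_Pair1'[of x borel P] G1[OF g]] by simp
  have G3[measurable]: "(\<lambda>x. \<integral>\<^sup>+\<omega>. indicator W x * g (x, insert x \<omega>) \<partial>P) \<in> borel_measurable borel"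
    if [measurable]: "g \<in> borel_measurable ?M" for g :: "_ \<Rightarrow> ennreal"
    using G1[OF that] by measurable
  \<comment> \<open>Both functionals are additive, homogeneous and continuous along increasing sequences.\<close>
  have Fadd: "F (\<lambda>p. g p + h p) = F g + F h" if [measurable]: "g \<in> borel_measurable ?M" "h \<in> borel_measurable ?M" for g h
  proof -
    have "F (\<lambda>p. g p + h p) = (\<integral>\<^sup>+\<omega>. (\<integral>\<^sup>+x. indicator W x * g (x, \<omega>) \<partial>config_measure \<omega>) +
        (\<integral>\<^sup>+x. indicator W x * h (x, \<omega>) \<partial>config_measure \<omega>) \<partial>P)"
      unfolding F_def distrib_left
      by (intro nn_integral_cong nn_integral_add) (use F1 that in simp_all)
    then show ?thesis
      unfolding F_def using F2 that by (simp add: nn_integral_add)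
  qed
  have Gadd: "G (\<lambda>p. g p + h p) = G g + G h" if [measurable]: "g \<in> borel_measurable ?M" "h \<in> borel_measurable ?M" for g h
    unfolding G_def distrib_left using G2 G3 that by (simp add: nn_integral_add)
  have Fcmult: "F (\<lambda>p. c * g p) = c * F g" if [measurable]: "g \<in> borel_measurable ?M" for c g
  proof -
    have "F (\<lambda>p. c * g p) = (\<integral>\<^sup>+\<omega>. c * (\<integral>\<^sup>+x. indicator W x * g (x, \<omega>) \<partial>config_measure \<omega>) \<partial>P)"
      unfolding F_def mult.left_commute[of _ c]
      by (intro nn_integral_cong nn_integral_cmult) (use F1 that in simp_all)
    then show ?thesis
      unfolding F_def using F2 that by (simp add: nn_integral_cmult)
  qed
  have Gcmult: "G (\<lambda>p. c * g p) = c * G g" if [measurable]: "g \<in> borel_measurable ?M" for c g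
    unfolding G_def mult.left_commute[of _ c] using G2 G3 that by (simp add: nn_integral_cmult)
  have FSUP: "F (\<lambda>p. SUP i. U i p) = (SUP i. F (U i))"
    if U[measurable]: "\<And>i. U i \<in> borel_measurable ?M" and inc: "incseq U" for U :: "nat \<Rightarrow> _"
  proof -
    have le: "U i p \<le> U j p" if "i \<le> j" for i j p
      using le_funD[OF incseqD[OF inc that]] .
    have "F (\<lambda>p. SUP i. U i p) = (\<integral>\<^sup>+\<omega>. (SUP i. \<integral>\<^sup>+x. indicator W x * U i (x, \<omega>) \<partial>config_measure \<omega>) \<partial>P)"
      unfolding F_def SUP_mult_left_ennreal
      by (intro nn_integral_cong nn_integral_monotone_convergence_SUP)
        (use F1[OF _ U] le in \<open>auto simp: incseq_def le_fun_def intro!: mult_left_mono\<close>)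
    also have "\<dots> = (SUP i. F (U i))"
      unfolding F_def
      by (intro nn_integral_monotone_convergence_SUP F2)
        (use le in \<open>auto simp: incseq_def le_fun_def intro!: nn_integral_mono mult_left_mono\<close>)
    finally show ?thesis .
  qed
  have GSUP: "G (\<lambda>p. SUP i. U i p) = (SUP i. G (U i))"
    if U[measurable]: "\<And>i. U i \<in> borel_measurable ?M" and inc: "incseq U" for U :: "nat \<Rightarrow> _"
  proof -
    have le: "U i p \<le> U j p" if "i \<le> j" for i j p
      using le_funD[OF incseqD[OF inc that]] .
    have "G (\<lambda>p. SUP i. U i p) = (\<integral>\<^sup>+x. (SUP i. \<integral>\<^sup>+\<omega>. indicator W x * U i (x, insert x \<omega>) \<partial>P) \<partial>\<sigma>)"
      unfolding G_def SUP_mult_left_ennreal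
      by (intro nn_integral_cong nn_integral_monotone_convergence_SUP)
        (use G2[OF U] le in \<open>auto simp: incseq_def le_fun_def intro!: mult_left_mono\<close>)
    also have "\<dots> = (SUP i. G (U i))"
      unfolding G_def
      by (intro nn_integral_monotone_convergence_SUP)
        (use G3[OF U] le in \<open>auto simp: incseq_def le_fun_def intro!: nn_integral_mono mult_left_mono\<close>)
    finally show ?thesis .
  qed
  let ?E = "{a \<times> b |a b. a \<in> sets (borel :: 'a measure) \<and> b \<in> void_event ` sets (borel :: 'a measure)}"
  have sets_M: "sets ?M = sigma_sets (UNIV \<times> configurations) ?E"
  proof -
    have "sets ?M = sets (sigma (space (borel :: 'a measure) \<times> space (config_space :: 'a set measure)) ?E)"
    proof (rule sets_pair_eq)
      show "void_event ` sets (borel :: 'a measure) \<subseteq> Pow (space config_space)"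
        by (auto simp: space_config_space void_event_def)
      show "sets (config_space :: 'a set measure) = sigma_sets (space config_space) (void_event ` sets borel)"
        by (simp add: sets_config_space_void space_config_space)
      show "sets (borel :: 'a measure) = sigma_sets (space borel) (sets borel)"
        by (metis sets.sigma_sets_eq)
      show "{void_event {}} \<subseteq> void_event ` sets (borel :: 'a measure)" by auto
      show "\<Union>{void_event {}} = space (config_space :: 'a set measure)"
        by (auto simp: void_event_def space_config_space)
      show "{UNIV} \<subseteq> sets (borel :: 'a measure)" by auto
    qed auto
    also have "\<dots> = sigma_sets (UNIV \<times> configurations) ?E"
      by (subst sets_measure_of) (auto simp: space_config_space void_event_def)
    finally show ?thesis .
  qed
  \<comment> \<open>They agree on a generator, and the total mass is finite, as taking complements requires.\<close>
  have rect: "F (indicator (A \<times> void_event B)) = G (indicator (A \<times> void_event B))"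
    if "A \<in> sets borel" "B \<in> sets borel" for A B
    unfolding F_def G_def using mecke_window_rectangle[OF assms(1) that W] .
  have total: "F (indicator (UNIV \<times> configurations)) = G (indicator (UNIV \<times> configurations))"
      "F (indicator (UNIV \<times> configurations)) \<noteq> \<infinity>"
  proof -
    have *: "void_event {} = configurations" by (auto simp: void_event_def)
    show "F (indicator (UNIV \<times> configurations)) = G (indicator (UNIV \<times> configurations))"
      using rect[of UNIV "{}"] by (simp add: *)
    have "F (indicator (UNIV \<times> configurations)) = (\<integral>\<^sup>+\<omega>. emeasure (config_measure \<omega>) W \<partial>P)"
      unfolding F_def by (intro nn_integral_cong) (simp add: indicator_times)
    then show "F (indicator (UNIV \<times> configurations)) \<noteq> \<infinity>"
      using W by (simp add: expected_count less_top)
  qed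
  have Est: "Int_stable ?E"
    unfolding Int_stable_def
  proof (intro ballI)
    fix X Y assume "X \<in> ?E" "Y \<in> ?E"
    then obtain A B A' B' where "X = A \<times> void_event B" "Y = A' \<times> void_event B'"
      and [measurable]: "A \<in> sets borel" "A' \<in> sets borel" "B \<in> sets borel" "B' \<in> sets borel"
      by auto
    then have "X \<inter> Y = (A \<inter> A') \<times> void_event (B \<union> B')"
      by (auto simp: void_event_def)
    moreover have "A \<inter> A' \<in> sets borel" "void_event (B \<union> B') \<in> void_event ` sets borel"
      by auto
    ultimately show "X \<inter> Y \<in> ?E"
      unfolding mem_Collect_eq by (intro exI conjI)
  qed
  have Esub: "?E \<subseteq> Pow (UNIV \<times> configurations)"
    by (auto simp: void_event_def)
  have FG_indicator: "F (indicator C) = G (indicator C)" if "C \<in> sets ?M" for C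
    using Est Esub that[unfolded sets_M]
  proof (induction C rule: sigma_sets_induct_disjoint)
    case (basic C)
    then show ?case using rect by auto
  next
    case empty
    then show ?case by (simp add: F_def G_def)
  next
    case (compl C)
    let ?O = "UNIV \<times> configurations :: ('a \<times> 'a set) set"
    have C: "C \<in> sets ?M" using compl sets_M by simp
    then have sub: "C \<subseteq> ?O" using sets.sets_into_space sp by metis
    have C'[measurable]: "?O - C \<in> sets ?M" using sets.compl_sets[OF C] sp by simp
    note C[measurable]
    have eq: "indicator ?O = (\<lambda>p. indicator C p + indicator (?O - C) p :: ennreal)"
      using sub by (auto simp: fun_eq_iff split: split_indicator)
    have Feq: "F (indicator ?O) = F (indicator C) + F (indicator (?O - C))"
      unfolding eq by (rule Fadd) measurable
    have Geq: "G (indicator ?O) = G (indicator C) + G (indicator (?O - C))"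
      unfolding eq by (rule Gadd) measurable
    have "F (indicator C) + F (indicator (?O - C)) = F (indicator C) + G (indicator (?O - C))"
      unfolding Feq[symmetric] total(1) unfolding Geq compl.IH ..
    moreover have "F (indicator C) \<noteq> top"
      using total(2) unfolding Feq by auto
    ultimately show ?case
      by (auto simp: ennreal_add_left_cancel)
  next
    case (union C)
    have [measurable]: "C i \<in> sets ?M" for i using union sets_M by auto
    let ?U = "\<lambda>n p. (\<Sum>i<n. indicator (C i) p) :: ennreal"
    have eq: "indicator (\<Union>i. C i) = (\<lambda>p. SUP n. ?U n p)"
      using union.hyps(1) by (simp add: fun_eq_iff suminf_indicator[symmetric] suminf_eq_SUP)
    have inc: "incseq ?U"
      by (auto simp: incseq_def le_fun_def intro!: sum_mono2)
    have "F (?U n) = G (?U n)" for n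
    proof (induction n)
      case 0
      then show ?case by (simp add: F_def G_def)
    next
      case (Suc n)
      then show ?case using union.IH by (simp add: Fadd Gadd)
    qed
    moreover have "F (\<lambda>p. SUP n. ?U n p) = (SUP n. F (?U n))"
      by (rule FSUP[OF _ inc]) measurable
    moreover have "G (\<lambda>p. SUP n. ?U n p) = (SUP n. G (?U n))"
      by (rule GSUP[OF _ inc]) measurable
    ultimately show ?case
      unfolding eq by simp
  qed
  have "F f = G f"
    using f
  proof (induction rule: borel_measurable_induct)
    case (cong f g)
    have "F f = F g"
      unfolding F_def using cong(3) by (intro nn_integral_cong) (simp add: sp)
    moreover have "G f = G g"
      unfolding G_def using cong(3)
      by (intro nn_integral_cong) (simp add: sp configuration_insert)
    ultimately show ?case using cong by simp
  next
    case (set A)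
    then show ?case by (rule FG_indicator)
  next
    case (mult u c)
    then show ?case by (simp add: Fcmult Gcmult)
  next
    case (add u v)
    then show ?case by (simp add: Fadd Gadd)
  next
    case (seq U)
    then show ?case by (simp add: FSUP GSUP SUP_apply image_comp)
  qed
  then show ?thesis unfolding F_def G_def .
qed

text \<open>Sum over a countable partition of the space into windows of finite intensity.\<close>

theorem mecke:
  assumes f[measurable]: "(\<lambda>(x, \<omega>). f x \<omega>) \<in> borel_measurable (borel \<Otimes>\<^sub>M config_space)"
  shows "(\<integral>\<^sup>+\<omega>. \<integral>\<^sup>+x. f x \<omega> \<partial>config_measure \<omega> \<partial>P) = (\<integral>\<^sup>+x. \<integral>\<^sup>+\<omega>. f x (insert x \<omega>) \<partial>P \<partial>\<sigma>)"
proof -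
  obtain A :: "nat \<Rightarrow> 'a set" where A[measurable]: "\<And>n. A n \<in> sets borel" and A': "disjoint_family A"
      "(\<Union>n. A n) = UNIV" "\<And>n. \<exists>K. compact K \<and> A n \<subseteq> K"
    using countable_compact_window_partition[OF locally_compact] by metis
  have fin: "emeasure \<sigma> (A n) < \<infinity>" for n
    using A'(3) intensity_finite by metis
  have fx: "(\<lambda>x. f x \<omega>) \<in> borel_measurable borel" if "\<omega> \<in> configurations" for \<omega>
    using measurable_compose[OF measurable_Pair2'[of \<omega> config_space borel] f] that by (simp add: space_config_space)
  have "(\<lambda>(x, \<omega>). (x, insert x \<omega>)) \<in> measurable (borel \<Otimes>\<^sub>M P) (borel \<Otimes>\<^sub>M (config_space :: 'a set measure))"
    using measurable_insert_point by (auto simp: case_prod_beta' cong: measurable_cong_sets)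
  from measurable_compose[OF this f]
  have fi: "(\<lambda>(x, \<omega>). f x (insert x \<omega>)) \<in> borel_measurable (borel \<Otimes>\<^sub>M P)"
    by (simp add: case_prod_beta')
  have "(\<integral>\<^sup>+\<omega>. \<integral>\<^sup>+x. f x \<omega> \<partial>config_measure \<omega> \<partial>P) =
      (\<integral>\<^sup>+\<omega>. (\<Sum>n. \<integral>\<^sup>+x. indicator (A n) x * f x \<omega> \<partial>config_measure \<omega>) \<partial>P)"
    using A' fx by (intro nn_integral_cong nn_integral_countable_partition) auto
  also have "\<dots> = (\<Sum>n. \<integral>\<^sup>+\<omega>. \<integral>\<^sup>+x. indicator (A n) x * f x \<omega> \<partial>config_measure \<omega> \<partial>P)"
    by (intro nn_integral_suminf measurable_nn_integral_config_measure[OF locally_compact]) measurable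
  also have "\<dots> = (\<Sum>n. \<integral>\<^sup>+x. \<integral>\<^sup>+\<omega>. indicator (A n) x * f x (insert x \<omega>) \<partial>P \<partial>\<sigma>)"
    using mecke_window[OF A fin f] by simp
  also have "\<dots> = (\<Sum>n. \<integral>\<^sup>+x. indicator (A n) x * (\<integral>\<^sup>+\<omega>. f x (insert x \<omega>) \<partial>P) \<partial>\<sigma>)"
    using measurable_compose[OF measurable_Pair1' fi]
    by (simp add: nn_integral_cmult)
  also have "\<dots> = (\<integral>\<^sup>+x. \<integral>\<^sup>+\<omega>. f x (insert x \<omega>) \<partial>P \<partial>\<sigma>)"
    using A' fi by (intro nn_integral_countable_partition[symmetric]) auto
  finally show ?thesis .
qed

end

section \<open>Finite products of measures\<close>

text \<open>Renaming coordinates along a bijection maps boxes to boxes with the same factors, and the product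
measure is determined by its values on boxes.\<close>

lemma (in product_sigma_finite) product_nn_integral_reindex:
  assumes J: "finite J" and h: "bij_betw h J K"
    and g[measurable]: "g \<in> borel_measurable (PiM J (\<lambda>j. M (h j)))"
  shows "(\<integral>\<^sup>+z. g (\<lambda>j\<in>J. z (h j)) \<partial>PiM K M) = (\<integral>\<^sup>+y. g y \<partial>PiM J (\<lambda>j. M (h j)))"
proof -
  interpret J: product_sigma_finite "\<lambda>j. M (h j)"
    by (rule product_sigma_finite.intro) (rule sigma_finite_measures)
  have K: "finite K" using J h bij_betw_finite by blast
  have hJ: "h j \<in> K" if "j \<in> J" for j using h that bij_betwE by blast
  have T[measurable]: "(\<lambda>z. \<lambda>j\<in>J. z (h j)) \<in> measurable (PiM K M) (PiM J (\<lambda>j. M (h j)))"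
    using hJ by (intro measurable_restrict measurable_component_singleton)
  have "distr (PiM K M) (PiM J (\<lambda>j. M (h j))) (\<lambda>z. \<lambda>j\<in>J. z (h j)) = PiM J (\<lambda>j. M (h j))"
  proof (rule J.PiM_eqI[OF J])
    fix A assume A: "\<And>j. j \<in> J \<Longrightarrow> A j \<in> sets (M (h j))"
    let ?k = "inv_into J h"
    have k: "?k k \<in> J" "h (?k k) = k" if "k \<in> K" for k
      using h that by (auto simp: bij_betw_def inv_into_into f_inv_into_f)
    have kh: "?k (h j) = j" if "j \<in> J" for j
      using h that by (auto simp: bij_betw_def)
    have A': "A (?k k) \<in> sets (M k)" if "k \<in> K" for k
      using A[OF k(1)[OF that]] k(2)[OF that] by simp
    have AJ: "A j \<subseteq> space (M (h j))" if "j \<in> J" for j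
      using A[OF that] by (rule sets.sets_into_space)
    have "(\<lambda>z. \<lambda>j\<in>J. z (h j)) -` Pi\<^sub>E J A \<inter> space (PiM K M) = (\<Pi>\<^sub>E k\<in>K. A (?k k))"
    proof (intro set_eqI iffI)
      fix z assume z: "z \<in> (\<lambda>z. \<lambda>j\<in>J. z (h j)) -` Pi\<^sub>E J A \<inter> space (PiM K M)"
      then have "z (h (?k k)) \<in> A (?k k)" if "k \<in> K" for k
        using k[OF that] by (auto simp: PiE_iff)
      with z k show "z \<in> (\<Pi>\<^sub>E k\<in>K. A (?k k))"
        by (auto simp: PiE_iff space_PiM)
    next
      fix z assume z: "z \<in> (\<Pi>\<^sub>E k\<in>K. A (?k k))"
      have "z (h j) \<in> A j" if "j \<in> J" for j
        using z hJ[OF that] kh[OF that] by (auto simp: PiE_iff)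
      moreover have "z \<in> space (PiM K M)"
        using z sets.sets_into_space[OF A'] by (fastforce simp: space_PiM PiE_iff)
      ultimately show "z \<in> (\<lambda>z. \<lambda>j\<in>J. z (h j)) -` Pi\<^sub>E J A \<inter> space (PiM K M)"
        by auto
    qed
    then have "emeasure (distr (PiM K M) (PiM J (\<lambda>j. M (h j))) (\<lambda>z. \<lambda>j\<in>J. z (h j))) (Pi\<^sub>E J A) =
        emeasure (PiM K M) (\<Pi>\<^sub>E k\<in>K. A (?k k))"
      using A J by (subst emeasure_distr[OF T sets_PiM_I_finite]) auto
    also have "\<dots> = (\<Prod>k\<in>K. emeasure (M k) (A (?k k)))"
      using K A' by (rule emeasure_PiM)
    also have "\<dots> = (\<Prod>j\<in>J. emeasure (M (h j)) (A (?k (h j))))"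
      by (rule prod.reindex_bij_betw[OF h, symmetric])
    also have "\<dots> = (\<Prod>j\<in>J. emeasure (M (h j)) (A j))"
      using kh by simp
    finally show "emeasure (distr (PiM K M) (PiM J (\<lambda>j. M (h j))) (\<lambda>z. \<lambda>j\<in>J. z (h j))) (Pi\<^sub>E J A) =
        (\<Prod>j\<in>J. emeasure (M (h j)) (A j))" .
  qed simp
  then show ?thesis
    using nn_integral_distr[OF T, of g] g by (simp add: measurable_distr_eq1)
qed

text \<open>Fubini for a family of functions that depend on disjoint groups of coordinates.\<close>

lemma (in product_sigma_finite) prod_nn_integral_groups:
  assumes "finite A" "disjoint_family_on J A" "\<And>a. a \<in> A \<Longrightarrow> finite (J a)"
    and "\<And>a. a \<in> A \<Longrightarrow> F a \<in> borel_measurable (PiM (J a) M)"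
  shows "(\<Prod>a\<in>A. \<integral>\<^sup>+z. F a z \<partial>PiM (J a) M) =
    (\<integral>\<^sup>+z. (\<Prod>a\<in>A. F a (restrict z (J a))) \<partial>PiM (\<Union>a\<in>A. J a) M)"
  using assms
proof (induction A rule: finite_induct)
  case empty
  show ?case by (simp add: PiM_empty nn_integral_count_space_finite)
next
  case (insert a A)
  let ?U = "\<Union>b\<in>A. J b"
  have disj: "J a \<inter> ?U = {}"
    using insert.prems(1) insert.hyps(2) by (auto simp: disjoint_family_on_def)
  have IH: "(\<Prod>b\<in>A. \<integral>\<^sup>+z. F b z \<partial>PiM (J b) M) = (\<integral>\<^sup>+z. (\<Prod>b\<in>A. F b (restrict z (J b))) \<partial>PiM ?U M)"
    using insert.prems by (intro insert.IH) (auto simp: disjoint_family_on_def)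
  have mF: "(\<lambda>z. F b (restrict z (J b))) \<in> borel_measurable (PiM V M)" if "b \<in> insert a A" "J b \<subseteq> V" for b V
    using measurable_compose[OF measurable_restrict_subset[OF that(2)] insert.prems(3)[OF that(1)]] .
  have Fa: "F a \<in> borel_measurable (PiM (J a) M)" using insert.prems by simp
  have FA: "(\<lambda>z. \<Prod>b\<in>A. F b (restrict z (J b))) \<in> borel_measurable (PiM ?U M)"
    by (intro borel_measurable_prod_ennreal mF) auto
  have "(\<integral>\<^sup>+z. (\<Prod>b\<in>insert a A. F b (restrict z (J b))) \<partial>PiM (J a \<union> ?U) M) =
    (\<integral>\<^sup>+x. \<integral>\<^sup>+y. (\<Prod>b\<in>insert a A. F b (restrict (merge (J a) ?U (x, y)) (J b))) \<partial>PiM ?U M \<partial>PiM (J a) M)"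
    using insert.prems insert.hyps
    by (intro product_nn_integral_fold[OF disj] borel_measurable_prod_ennreal mF) auto
  also have "\<dots> = (\<integral>\<^sup>+x. \<integral>\<^sup>+y. F a x * (\<Prod>b\<in>A. F b (restrict y (J b))) \<partial>PiM ?U M \<partial>PiM (J a) M)"
  proof (intro nn_integral_cong)
    fix x y assume x: "x \<in> space (PiM (J a) M)"
    have "restrict (merge (J a) ?U (x, y)) (J a) = x"
      using x disj by (simp add: space_PiM PiE_restrict)
    moreover have "restrict (merge (J a) ?U (x, y)) (J b) = restrict y (J b)" if "b \<in> A" for b
      using that disj by (auto simp: merge_def fun_eq_iff restrict_def)
    ultimately show "(\<Prod>b\<in>insert a A. F b (restrict (merge (J a) ?U (x, y)) (J b))) =
        F a x * (\<Prod>b\<in>A. F b (restrict y (J b)))"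
      using insert.hyps by simp
  qed
  also have "\<dots> = (\<integral>\<^sup>+x. F a x \<partial>PiM (J a) M) * (\<integral>\<^sup>+y. (\<Prod>b\<in>A. F b (restrict y (J b))) \<partial>PiM ?U M)"
    using Fa FA by (simp add: nn_integral_cmult nn_integral_multc)
  also have "\<dots> = (\<Prod>b\<in>insert a A. \<integral>\<^sup>+z. F b z \<partial>PiM (J b) M)"
    unfolding IH[symmetric] using insert.hyps by simp
  finally show ?case by (simp only: UN_insert)
qed

text \<open>A diagonal \<open>y i = y j\<close> is null: with the other coordinates fixed, \<open>y i\<close> is confined to one point.\<close>

lemma AE_PiM_inj_on:
  fixes \<sigma> :: "'a::{metric_space,second_countable_topology} measure"
  assumes "sigma_finite_measure \<sigma>" and s[measurable_cong]: "sets \<sigma> = sets borel"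
    and null: "\<And>x. emeasure \<sigma> {x} = 0" and J: "finite J"
  shows "AE y in PiM J (\<lambda>_. \<sigma>). inj_on y J"
proof -
  interpret product_sigma_finite "\<lambda>_. \<sigma>"
    by (rule product_sigma_finite.intro) fact
  have "AE y in PiM J (\<lambda>_. \<sigma>). y i \<noteq> y j" if ij: "i \<in> J" "j \<in> J" "i \<noteq> j" for i j
  proof -
    let ?M = "PiM J (\<lambda>_. \<sigma>)" and ?J = "J - {i}"
    have J': "J = insert i ?J" using ij by auto
    let ?D = "{y \<in> space ?M. y i = y j}"
    have comp: "(\<lambda>y. y k) \<in> borel_measurable ?M" if "k \<in> J" for k
      using measurable_component_singleton[OF that, of "\<lambda>_. \<sigma>"] by (simp add: measurable_cong_sets[OF refl s])
    have D: "?D \<in> sets ?M"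
      using comp[OF ij(1)] comp[OF ij(2)] by measurable
    have "emeasure ?M ?D = (\<integral>\<^sup>+y. indicator ?D y \<partial>PiM (insert i ?J) (\<lambda>_. \<sigma>))"
      using D J' by simp
    also have "\<dots> = (\<integral>\<^sup>+x. \<integral>\<^sup>+t. indicator ?D (x(i := t)) \<partial>\<sigma> \<partial>PiM ?J (\<lambda>_. \<sigma>))"
      using D J J' by (intro product_nn_integral_insert) auto
    also have "\<dots> = (\<integral>\<^sup>+x. 0 \<partial>PiM ?J (\<lambda>_. \<sigma>))"
    proof (intro nn_integral_cong)
      fix x
      have "(\<integral>\<^sup>+t. indicator ?D (x(i := t)) \<partial>\<sigma>) \<le> (\<integral>\<^sup>+t. indicator {x j} t \<partial>\<sigma>)"
        using ij by (intro nn_integral_mono) (auto split: split_indicator)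
      also have "\<dots> = 0" using null by (simp add: s)
      finally show "(\<integral>\<^sup>+t. indicator ?D (x(i := t)) \<partial>\<sigma>) = 0" by simp
    qed
    finally have "emeasure ?M ?D = 0" by simp
    with D show ?thesis
      by (intro AE_I[of _ _ ?D]) auto
  qed
  then have "AE y in PiM J (\<lambda>_. \<sigma>). \<forall>i\<in>J. \<forall>j\<in>J. i \<noteq> j \<longrightarrow> y i \<noteq> y j"
    using J by (intro AE_finite_allI AE_impI) auto
  then show ?thesis
    by eventually_elim (auto simp: inj_on_def)
qed

section \<open>Partitions and the addition of an index\<close>

definition block_of :: "'i set set \<Rightarrow> 'i \<Rightarrow> 'i set" where
  "block_of Q s = (THE B. B \<in> Q \<and> s \<in> B)"

lemma block_of_eq:
  assumes "partition_on A Q" "B \<in> Q" "s \<in> B"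
  shows "block_of Q s = B"
  unfolding block_of_def
  using assms by (intro the_equality) (auto simp: partition_on_def disjoint_def)

lemma block_of_mem:
  assumes "partition_on A Q" "s \<in> A"
  shows "block_of Q s \<in> Q" "s \<in> block_of Q s"
proof -
  obtain B where "B \<in> Q" "s \<in> B" using assms by (auto simp: partition_on_def)
  with block_of_eq[OF assms(1)] show "block_of Q s \<in> Q" "s \<in> block_of Q s" by simp_all
qed

lemma partition_on_remove_block:
  assumes "partition_on A Q" "C \<in> Q"
  shows "disjnt C (\<Union>(Q - {C}))" "partition_on (A - C) (Q - {C})" "C \<subseteq> A" "C \<noteq> {}"
proof -
  show d: "disjnt C (\<Union>(Q - {C}))"
    using assms by (auto simp: partition_on_def disjoint_def disjnt_def)
  have "partition_on A (insert C (Q - {C}))"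
    using assms by (simp add: insert_absorb)
  with partition_on_insert[OF d, of A]
  show "partition_on (A - C) (Q - {C})" "C \<subseteq> A" "C \<noteq> {}" by simp_all
qed

text \<open>For a typed partition these are its blocks of type 1: the ones whose point is added to the configuration,
and the ones that a further index of type 1 may join.\<close>

definition full_blocks :: "('i \<Rightarrow> nat) \<Rightarrow> 'i set set \<Rightarrow> 'i set set" where
  "full_blocks \<epsilon> Q = {B \<in> Q. \<forall>t\<in>B. \<epsilon> t = 1}"

definition partition_extensions :: "('i \<Rightarrow> nat) \<Rightarrow> 'i \<Rightarrow> 'i set set \<Rightarrow> 'i set set set" where
  "partition_extensions \<epsilon> s Q = insert (insert {s} Q)
     (if \<epsilon> s = 1 then (\<lambda>B. insert (insert s B) (Q - {B})) ` full_blocks \<epsilon> Q else {})"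

lemma partition_on_join_block:
  assumes Q: "partition_on S Q" and s: "s \<notin> S" and B: "B \<in> Q"
  shows "partition_on (insert s S) (insert (insert s B) (Q - {B}))"
proof -
  note r = partition_on_remove_block[OF Q B]
  have "\<Union>(Q - {B}) \<subseteq> S" using Q by (auto simp: partition_on_def)
  then have "disjnt (insert s B) (\<Union>(Q - {B}))"
    using r(1) s by (auto simp: disjnt_def)
  moreover have "insert s S - insert s B = S - B" using s by auto
  ultimately show ?thesis
    using r by (subst partition_on_insert) auto
qed

lemma partition_on_add_singleton:
  assumes "partition_on S Q" "s \<notin> S"
  shows "partition_on (insert s S) (insert {s} Q)"
proof -
  have "disjnt {s} (\<Union>Q)" "insert s S - {s} = S"
    using assms by (auto simp: partition_on_def disjnt_def)
  with assms show ?thesis by (subst partition_on_insert) auto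
qed

lemma typed_partitions_insert:
  assumes S: "finite S" and s: "s \<notin> S"
  shows "typed_partitions (insert s S) \<epsilon> = (\<Union>Q\<in>typed_partitions S \<epsilon>. partition_extensions \<epsilon> s Q)"
proof (intro set_eqI iffI)
  fix R assume "R \<in> typed_partitions (insert s S) \<epsilon>"
  then have R: "partition_on (insert s S) R" and ty: "\<And>B. B \<in> R \<Longrightarrow> card B > 1 \<Longrightarrow> \<forall>t\<in>B. \<epsilon> t = 1"
    by (auto simp: typed_partitions_def)
  obtain C where C: "C \<in> R" "s \<in> C"
    using R by (auto simp: partition_on_def)
  note r = partition_on_remove_block[OF R C(1)]
  have Rins: "R = insert C (R - {C})" using C by auto
  show "R \<in> (\<Union>Q\<in>typed_partitions S \<epsilon>. partition_extensions \<epsilon> s Q)"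
  proof (cases "C = {s}")
    case True
    have "insert s S - C = S" using s True by auto
    with r(2) ty have "R - {C} \<in> typed_partitions S \<epsilon>"
      by (auto simp: typed_partitions_def)
    moreover have "R \<in> partition_extensions \<epsilon> s (R - {C})"
      using Rins True by (auto simp: partition_extensions_def)
    ultimately show ?thesis by blast
  next
    case False
    define B where "B = C - {s}"
    have B: "B \<noteq> {}" "C = insert s B" "B \<subseteq> S" using False C r(3) by (auto simp: B_def)
    have dB: "disjnt B (\<Union>(R - {C}))" using r(1) B by (auto simp: disjnt_def)
    have finC: "finite C" using r(3) S finite_subset by blast
    have "card B > 0"
      using B(1) finC by (simp add: B_def card_gt_0_iff)
    then have "card C > 1"
      using card_Suc_Diff1[OF finC C(2)] by (simp add: B_def)
    then have ty1: "\<forall>t\<in>C. \<epsilon> t = 1" using ty C by blast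
    define Q where "Q = insert B (R - {C})"
    have "insert s S - C = S - B" using B s by auto
    then have "partition_on S Q"
      unfolding Q_def using r(2) B by (subst partition_on_insert[OF dB]) auto
    then have Q: "Q \<in> typed_partitions S \<epsilon>"
      using ty ty1 B by (auto simp: typed_partitions_def Q_def)
    have "B \<notin> R - {C}" using dB B by (auto simp: disjnt_def)
    then have QR: "Q - {B} = R - {C}"
      unfolding Q_def by (rule Diff_insert_absorb)
    have "R = insert (insert s B) (Q - {B})"
      unfolding QR B(2)[symmetric] by (rule Rins)
    moreover have "B \<in> full_blocks \<epsilon> Q" using ty1 B by (auto simp: full_blocks_def Q_def)
    moreover have "\<epsilon> s = 1" using ty1 C by auto
    ultimately have "R \<in> partition_extensions \<epsilon> s Q"
      by (auto simp: partition_extensions_def)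
    with Q show ?thesis by blast
  qed
next
  fix R assume "R \<in> (\<Union>Q\<in>typed_partitions S \<epsilon>. partition_extensions \<epsilon> s Q)"
  then obtain Q where Q: "partition_on S Q" and ty: "\<And>B. B \<in> Q \<Longrightarrow> card B > 1 \<Longrightarrow> \<forall>t\<in>B. \<epsilon> t = 1"
    and R: "R \<in> partition_extensions \<epsilon> s Q"
    by (auto simp: typed_partitions_def)
  show "R \<in> typed_partitions (insert s S) \<epsilon>"
  proof (cases "R = insert {s} Q")
    case True
    with partition_on_add_singleton[OF Q s] ty show ?thesis
      by (auto simp: typed_partitions_def)
  next
    case False
    then obtain B where "\<epsilon> s = 1" "B \<in> full_blocks \<epsilon> Q" "R = insert (insert s B) (Q - {B})"
      using R by (auto simp: partition_extensions_def split: if_splits)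
    with partition_on_join_block[OF Q s] ty show ?thesis
      by (auto simp: typed_partitions_def full_blocks_def)
  qed
qed

text \<open>Deleting \<open>s\<close> recovers the partition that was extended, so different partitions have disjoint sets
of extensions.\<close>

lemma partition_extensions_restrict:
  assumes Q: "partition_on S Q" and s: "s \<notin> S" and R: "R \<in> partition_extensions \<epsilon> s Q"
  shows "(\<lambda>B. B - {s}) ` R - {{}} = Q"
proof -
  have id: "B - {s} = B" if "B \<in> Q" for B
    using Q s that by (auto simp: partition_on_def)
  then have im: "(\<lambda>B. B - {s}) ` X = X" if "X \<subseteq> Q" for X
    using that by (force simp: image_def)
  have ne: "{} \<notin> Q" using Q by (simp add: partition_on_def)
  show ?thesis
  proof (cases "R = insert {s} Q")
    case True
    with im[of Q] ne show ?thesis by auto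
  next
    case False
    then obtain B where "B \<in> Q" "R = insert (insert s B) (Q - {B})"
      using R by (auto simp: partition_extensions_def full_blocks_def split: if_splits)
    moreover from this have "insert s B - {s} = B" using id by auto
    ultimately show ?thesis using im[of "Q - {B}"] ne by auto
  qed
qed

lemma finite_typed_partitions: "finite S \<Longrightarrow> finite (typed_partitions S \<epsilon>)"
  by (rule finite_subset[OF _ finitely_many_partition_on]) (auto simp: typed_partitions_def)

lemma typed_partitions_finite_blocks:
  "finite S \<Longrightarrow> Q \<in> typed_partitions S \<epsilon> \<Longrightarrow> finite Q"
  by (auto simp: typed_partitions_def intro: finite_elements)

text \<open>The recursion for sums over typed partitions: the new index forms a block of its own or, if it has
type 1, joins a block of type 1. An index of type 0 cannot join any block.\<close>

lemma sum_typed_partitions_insert: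
  fixes g :: "'i set set \<Rightarrow> 'b::comm_monoid_add"
  assumes S: "finite S" and s: "s \<notin> S"
  shows "(\<Sum>R\<in>typed_partitions (insert s S) \<epsilon>. g R) =
    (\<Sum>Q\<in>typed_partitions S \<epsilon>. g (insert {s} Q) +
      (if \<epsilon> s = 1 then \<Sum>B\<in>full_blocks \<epsilon> Q. g (insert (insert s B) (Q - {B})) else 0))"
proof -
  have fin: "finite (full_blocks \<epsilon> Q)" if "Q \<in> typed_partitions S \<epsilon>" for Q
    using typed_partitions_finite_blocks[OF S that] by (auto simp: full_blocks_def)
  have part: "partition_on S Q" if "Q \<in> typed_partitions S \<epsilon>" for Q
    using that by (simp add: typed_partitions_def)
  have "(\<Sum>R\<in>typed_partitions (insert s S) \<epsilon>. g R) =
      (\<Sum>Q\<in>typed_partitions S \<epsilon>. \<Sum>R\<in>partition_extensions \<epsilon> s Q. g R)"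
    unfolding typed_partitions_insert[OF S s]
  proof (rule sum.UNION_disjoint)
    show "\<forall>Q\<in>typed_partitions S \<epsilon>. finite (partition_extensions \<epsilon> s Q)"
      using fin by (auto simp: partition_extensions_def)
    show "\<forall>Q\<in>typed_partitions S \<epsilon>. \<forall>Q'\<in>typed_partitions S \<epsilon>.
        Q \<noteq> Q' \<longrightarrow> partition_extensions \<epsilon> s Q \<inter> partition_extensions \<epsilon> s Q' = {}"
      using partition_extensions_restrict[OF part s] by blast
  qed (rule finite_typed_partitions[OF S])
  also have "\<dots> = (\<Sum>Q\<in>typed_partitions S \<epsilon>. g (insert {s} Q) +
      (if \<epsilon> s = 1 then \<Sum>B\<in>full_blocks \<epsilon> Q. g (insert (insert s B) (Q - {B})) else 0))"
  proof (rule sum.cong[OF refl])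
    fix Q assume Qt: "Q \<in> typed_partitions S \<epsilon>"
    note Q = part[OF Qt]
    have sQ: "s \<notin> B" "B \<noteq> {}" if "B \<in> Q" for B
      using Q s that by (auto simp: partition_on_def)
    have inj: "inj_on (\<lambda>B. insert (insert s B) (Q - {B})) (full_blocks \<epsilon> Q)"
    proof (rule inj_onI)
      fix B B' assume BB: "B \<in> full_blocks \<epsilon> Q" "B' \<in> full_blocks \<epsilon> Q"
        and eq: "insert (insert s B) (Q - {B}) = insert (insert s B') (Q - {B'})"
      then have B: "B \<in> Q" "B' \<in> Q" by (auto simp: full_blocks_def)
      have "insert s B \<in> insert (insert s B') (Q - {B'})" using eq by blast
      moreover have "insert s B \<notin> Q" using sQ by blast
      ultimately have "insert s B = insert s B'" by blast
      then show "B = B'" using sQ(1)[OF B(1)] sQ(1)[OF B(2)] by (metis insert_ident)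
    qed
    have "insert {s} Q \<noteq> insert (insert s B) (Q - {B})" if "B \<in> full_blocks \<epsilon> Q" for B
    proof
      assume eq: "insert {s} Q = insert (insert s B) (Q - {B})"
      have B: "B \<in> Q" using that by (auto simp: full_blocks_def)
      then have "B \<in> insert (insert s B) (Q - {B})" using eq by blast
      then have "B = insert s B" by blast
      with sQ[OF B] show False by blast
    qed
    then have notin: "insert {s} Q \<notin> (\<lambda>B. insert (insert s B) (Q - {B})) ` full_blocks \<epsilon> Q"
      by blast
    show "(\<Sum>R\<in>partition_extensions \<epsilon> s Q. g R) = g (insert {s} Q) +
      (if \<epsilon> s = 1 then \<Sum>B\<in>full_blocks \<epsilon> Q. g (insert (insert s B) (Q - {B})) else 0)"
      using fin[OF Qt] notin
      by (simp add: partition_extensions_def sum.reindex[OF inj])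
  qed
  finally show ?thesis .
qed

text \<open>The points added to the configuration can be listed by blocks in place of indices: a block with an
index of type 1 is either a singleton or, by typedness, entirely of type 1.\<close>

lemma typed_points_eq:
  assumes S: "finite S" and Q: "Q \<in> typed_partitions S \<epsilon>"
  shows "(\<lambda>t. y (block_of Q t)) ` {t \<in> S. \<epsilon> t = 1} = y ` full_blocks \<epsilon> Q"
proof -
  have part: "partition_on S Q" using Q by (simp add: typed_partitions_def)
  have "block_of Q ` {t \<in> S. \<epsilon> t = 1} = full_blocks \<epsilon> Q"
  proof (intro set_eqI iffI)
    fix B assume "B \<in> block_of Q ` {t \<in> S. \<epsilon> t = 1}"
    then obtain t where t: "t \<in> S" "\<epsilon> t = 1" "B = block_of Q t" by auto
    then have B: "B \<in> Q" "t \<in> B" using block_of_mem[OF part t(1)] by auto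
    have "finite B" using B part S by (auto simp: partition_on_def intro: finite_subset)
    have "\<forall>u\<in>B. \<epsilon> u = 1"
    proof (cases "card B > 1")
      case True
      then show ?thesis using Q B by (auto simp: typed_partitions_def)
    next
      case False
      moreover have "card B > 0"
        using B \<open>finite B\<close> by (auto simp: card_gt_0_iff)
      ultimately have "card B = 1" by simp
      then have Bt: "B = {t}" using B by (auto simp: card_1_singleton_iff)
      show ?thesis unfolding Bt using t(2) by simp
    qed
    with B show "B \<in> full_blocks \<epsilon> Q" by (simp add: full_blocks_def)
  next
    fix B assume B: "B \<in> full_blocks \<epsilon> Q"
    then have BQ: "B \<in> Q" by (simp add: full_blocks_def)
    then have "B \<noteq> {}" "B \<subseteq> S" using part by (auto simp: partition_on_def)
    then obtain t where "t \<in> B" "B \<subseteq> S" by blast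
    with B show "B \<in> block_of Q ` {t \<in> S. \<epsilon> t = 1}"
      using block_of_eq[OF part] by (intro image_eqI[of _ _ t]) (auto simp: full_blocks_def)
  qed
  then show ?thesis by (metis image_image)
qed

section \<open>Expectation of a mixed integral\<close>

context poisson_process
begin

text \<open>A point of positive mass would be an atom.\<close>

lemma intensity_singleton: "emeasure \<sigma> {x} = 0"
proof (rule ccontr)
  assume "emeasure \<sigma> {x} \<noteq> 0"
  then have "measure_atom \<sigma> {x}"
    by (auto simp: measure_atom_def zero_less_iff_neq_zero dest: subset_singletonD)
  then show False using non_atomic by (auto simp: non_atomic_def)
qed

lemma AE_avoids_point: "AE \<omega> in P. x \<notin> \<omega>"
proof -
  have "(\<integral>\<^sup>+\<omega>. emeasure (config_measure \<omega>) {x} \<partial>P) = 0"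
    using expected_count[of "{x}"] by (simp add: intensity_singleton)
  moreover have "(\<lambda>\<omega>. emeasure (config_measure \<omega>) {x}) \<in> borel_measurable P"
    using measurable_count[of "{x}"] by simp
  ultimately have "AE \<omega> in P. emeasure (config_measure \<omega>) {x} = 0"
    by (simp add: nn_integral_0_iff_AE)
  then show ?thesis
    by eventually_elim (auto simp: emeasure_config_measure emeasure_count_space_eq_0)
qed

sublocale PiS: product_sigma_finite "\<lambda>_. \<sigma>"
  by (rule product_sigma_finite.intro) unfold_locales

text \<open>The map \<open>q\<close> sends an index to the coordinate of \<open>y\<close> that represents it, so it encodes a partition by its
fibres. Keeping the set of coordinates arbitrary allows passing between the blocks themselves, the
blocks before and after an index is added, and the numbers \<open>1, \<dots>, k\<close>.\<close>

definition joint_integrand ::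
  "(('i \<Rightarrow> 'a) \<Rightarrow> 'a set \<Rightarrow> ennreal) \<Rightarrow> 'i set \<Rightarrow> ('i \<Rightarrow> nat) \<Rightarrow> ('i \<Rightarrow> 'j) \<Rightarrow> ('j \<Rightarrow> 'a) \<Rightarrow> 'a set \<Rightarrow> ennreal" where
  "joint_integrand F S \<epsilon> q y \<omega> = F (\<lambda>s\<in>S. y (q s)) (\<omega> \<union> (\<lambda>s. y (q s)) ` {s\<in>S. \<epsilon> s = 1})"

text \<open>The integral over \<open>\<omega>\<close> is the inner one, so that the Mecke equation applies for each fixed \<open>y\<close>.\<close>

definition partition_term ::
  "(('i \<Rightarrow> 'a) \<Rightarrow> 'a set \<Rightarrow> ennreal) \<Rightarrow> 'i set \<Rightarrow> ('i \<Rightarrow> nat) \<Rightarrow> ('i \<Rightarrow> 'j) \<Rightarrow> 'j set \<Rightarrow> ennreal" where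
  "partition_term F S \<epsilon> q J = (\<integral>\<^sup>+y. \<integral>\<^sup>+\<omega>. joint_integrand F S \<epsilon> q y \<omega> \<partial>P \<partial>PiM J (\<lambda>_. \<sigma>))"

lemma measurable_joint_integrand:
  assumes S: "finite S" and q: "\<And>s. s \<in> S \<Longrightarrow> q s \<in> J"
    and F: "(\<lambda>(z, \<omega>). F z \<omega>) \<in> borel_measurable (PiM S (\<lambda>_. borel) \<Otimes>\<^sub>M config_space)"
  shows "(\<lambda>(y, \<omega>). joint_integrand F S \<epsilon> q y \<omega>) \<in> borel_measurable (PiM J (\<lambda>_. \<sigma>) \<Otimes>\<^sub>M P)"
proof -
  let ?N = "PiM J (\<lambda>_. \<sigma>) \<Otimes>\<^sub>M P"
  have comp: "(\<lambda>p. fst p (q s)) \<in> borel_measurable ?N" if "s \<in> S" for s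
    using measurable_compose[OF measurable_fst measurable_component_singleton[OF q[OF that], of "\<lambda>_. \<sigma>"]]
    by (simp cong: measurable_cong_sets)
  have "snd \<in> measurable ?N (config_space :: 'a set measure)"
    using measurable_snd[of "PiM J (\<lambda>_. \<sigma>)" P] by (simp cong: measurable_cong_sets)
  then have "(\<lambda>p. snd p \<union> (\<lambda>s. fst p (q s)) ` {s\<in>S. \<epsilon> s = 1}) \<in> measurable ?N config_space"
    using S comp by (intro measurable_Un_points) auto
  moreover have "(\<lambda>p. \<lambda>s\<in>S. fst p (q s)) \<in> measurable ?N (PiM S (\<lambda>_. borel))"
    by (intro measurable_restrict comp)
  ultimately have "(\<lambda>p. (\<lambda>s\<in>S. fst p (q s), snd p \<union> (\<lambda>s. fst p (q s)) ` {s\<in>S. \<epsilon> s = 1}))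
      \<in> measurable ?N (PiM S (\<lambda>_. borel) \<Otimes>\<^sub>M config_space)"
    by (intro measurable_Pair) simp_all
  from measurable_compose[OF this F] show ?thesis
    by (simp add: joint_integrand_def case_prod_beta')
qed

lemma measurable_expected_joint_integrand:
  assumes "finite S" "\<And>s. s \<in> S \<Longrightarrow> q s \<in> J"
    and "(\<lambda>(z, \<omega>). F z \<omega>) \<in> borel_measurable (PiM S (\<lambda>_. borel) \<Otimes>\<^sub>M config_space)"
  shows "(\<lambda>y. \<integral>\<^sup>+\<omega>. joint_integrand F S \<epsilon> q y \<omega> \<partial>P) \<in> borel_measurable (PiM J (\<lambda>_. \<sigma>))"
  using measurable_joint_integrand[OF assms] by measurable

text \<open>Only the fibres of the coordinate map matter, not the names of the coordinates.\<close>

lemma partition_term_reindex: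
  assumes S: "finite S" and J: "finite J" and h: "bij_betw h J K" and q: "\<And>s. s \<in> S \<Longrightarrow> q s \<in> J"
    and q': "\<And>s. s \<in> S \<Longrightarrow> q' s = h (q s)"
    and F: "(\<lambda>(z, \<omega>). F z \<omega>) \<in> borel_measurable (PiM S (\<lambda>_. borel) \<Otimes>\<^sub>M config_space)"
  shows "partition_term F S \<epsilon> q' K = partition_term F S \<epsilon> q J"
proof -
  have "joint_integrand F S \<epsilon> q' z \<omega> = joint_integrand F S \<epsilon> q (\<lambda>j\<in>J. z (h j)) \<omega>" for z \<omega>
  proof -
    have "(\<lambda>s\<in>S. z (q' s)) = (\<lambda>s\<in>S. (\<lambda>j\<in>J. z (h j)) (q s))"
      using q q' by (auto simp: fun_eq_iff)
    moreover have "(\<lambda>s. z (q' s)) ` {s\<in>S. \<epsilon> s = 1} = (\<lambda>s. (\<lambda>j\<in>J. z (h j)) (q s)) ` {s\<in>S. \<epsilon> s = 1}"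
      using q q' by (intro image_cong) auto
    ultimately show ?thesis by (simp only: joint_integrand_def)
  qed
  then have "partition_term F S \<epsilon> q' K =
      (\<integral>\<^sup>+z. (\<lambda>y. \<integral>\<^sup>+\<omega>. joint_integrand F S \<epsilon> q y \<omega> \<partial>P) (\<lambda>j\<in>J. z (h j)) \<partial>PiM K (\<lambda>_. \<sigma>))"
    by (simp only: partition_term_def)
  also have "\<dots> = partition_term F S \<epsilon> q J"
    unfolding partition_term_def
    by (rule PiS.product_nn_integral_reindex[OF J h measurable_expected_joint_integrand[OF S q F]])
  finally show ?thesis .
qed

lemma sigma_finite_mixed:
  assumes "\<omega> \<in> configurations"
  shows "product_sigma_finite (\<lambda>s. if \<epsilon> s = (1::nat) then config_measure \<omega> else \<sigma>)"
  by (rule product_sigma_finite.intro)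
    (simp add: sigma_finite_config_measure[OF locally_compact assms] S.sigma_finite_measure_axioms)

lemma sets_PiM_mixed:
  "sets (PiM S (\<lambda>s. if \<epsilon> s = (1::nat) then config_measure \<omega> else \<sigma>)) = sets (PiM S (\<lambda>_. borel))"
  by (rule sets_PiM_cong) auto

lemma measurable_nn_integral_coordinate:
  fixes F :: "('i \<Rightarrow> 'a) \<Rightarrow> 'a set \<Rightarrow> ennreal"
  assumes F: "(\<lambda>(z, \<omega>). F z \<omega>) \<in> borel_measurable (PiM (insert s S) (\<lambda>_. borel) \<Otimes>\<^sub>M config_space)"
  shows "(\<lambda>(z, \<omega>). \<integral>\<^sup>+x. F (z(s := x)) \<omega> \<partial>(if \<epsilon> s = (1::nat) then config_measure \<omega> else \<sigma>))
    \<in> borel_measurable (PiM S (\<lambda>_. borel) \<Otimes>\<^sub>M config_space)"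
proof -
  let ?N = "PiM S (\<lambda>_. borel :: 'a measure) \<Otimes>\<^sub>M (config_space :: 'a set measure)"
  have "(\<lambda>p. ((fst (fst p))(s := snd p), snd (fst p)))
      \<in> measurable (?N \<Otimes>\<^sub>M borel) (PiM (insert s S) (\<lambda>_. borel) \<Otimes>\<^sub>M config_space)"
    by (intro measurable_Pair measurable_fun_upd[where J=S]) auto
  from measurable_compose[OF this F]
  have m: "(\<lambda>(a, x). F ((fst a)(s := x)) (snd a)) \<in> borel_measurable (?N \<Otimes>\<^sub>M borel)"
    by (simp add: case_prod_beta')
  show ?thesis
  proof (cases "\<epsilon> s = 1")
    case True
    then show ?thesis
      using measurable_nn_integral_config_measure[OF locally_compact measurable_snd m]
      by (simp add: case_prod_beta')
  next
    case False
    have "(\<lambda>(a, x). F ((fst a)(s := x)) (snd a)) \<in> borel_measurable (?N \<Otimes>\<^sub>M \<sigma>)"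
      using m by (simp cong: measurable_cong_sets)
    from S.borel_measurable_nn_integral[OF this] False show ?thesis
      by (simp add: case_prod_beta')
  qed
qed

text \<open>The induction step. The function \<open>F'\<close> arises from \<open>F\<close> by integrating out the coordinate \<open>s\<close>. If \<open>s\<close>
has type 0, exchanging this integral with the expectation gives the term of the partition with the new
block \<open>{s}\<close>. Let \<open>s\<close> have type 1. At the configuration \<open>\<omega> \<union> Y\<close>, with \<open>Y\<close> the points already added, an integral against the configuration is the
integral against \<open>\<omega>\<close> plus the sum over \<open>Y\<close>. By the Mecke equation the former is the term of the
partition with the new block \<open>{s}\<close>; the summand of the point of \<open>B\<close> is the term of the partition in which
\<open>s\<close> has joined \<open>B\<close>, where nothing new is added to the configuration.\<close>

lemma partition_term_insert:
  fixes F :: "('i \<Rightarrow> 'a) \<Rightarrow> 'a set \<Rightarrow> ennreal" and \<epsilon> :: "'i \<Rightarrow> nat"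
  assumes S: "finite S" and s: "s \<notin> S" and Q: "Q \<in> typed_partitions S \<epsilon>"
    and F: "(\<lambda>(z, \<omega>). F z \<omega>) \<in> borel_measurable (PiM (insert s S) (\<lambda>_. borel) \<Otimes>\<^sub>M config_space)"
  defines "F' \<equiv> \<lambda>z \<omega>. \<integral>\<^sup>+x. F (z(s := x)) \<omega> \<partial>(if \<epsilon> s = 1 then config_measure \<omega> else \<sigma>)"
  shows "partition_term F' S \<epsilon> (block_of Q) Q =
    partition_term F (insert s S) \<epsilon> (block_of (insert {s} Q)) (insert {s} Q) +
    (if \<epsilon> s = 1 then \<Sum>B\<in>full_blocks \<epsilon> Q. 
      partition_term F (insert s S) \<epsilon> (block_of (insert (insert s B) (Q - {B}))) (insert (insert s B) (Q - {B})) else 0)"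
proof -
  let ?S = "insert s S"
  let ?N = "PiM Q (\<lambda>_. \<sigma>)"
  have part: "partition_on S Q" using Q by (simp add: typed_partitions_def)
  have finQ: "finite Q" using typed_partitions_finite_blocks[OF S Q] .
  have finB: "finite (full_blocks \<epsilon> Q)" using finQ by (simp add: full_blocks_def)
  have sQ: "{s} \<notin> Q" "\<And>B. B \<in> Q \<Longrightarrow> s \<notin> B" using part s by (auto simp: partition_on_def)
  have bQ: "block_of Q t \<in> Q" "t \<in> block_of Q t" if "t \<in> S" for t using block_of_mem[OF part that] .
  have finS: "finite ?S" using S by simp
  define z where "z y = (\<lambda>t\<in>S. y (block_of Q t))" for y :: "'i set \<Rightarrow> 'a"
  define Y where "Y y = y ` full_blocks \<epsilon> Q" for y :: "'i set \<Rightarrow> 'a"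
  have Y_eq: "(\<lambda>t. y (block_of Q t)) ` {t\<in>S. \<epsilon> t = 1} = Y y" for y
    unfolding Y_def by (rule typed_points_eq[OF S Q])
  have finY: "finite (Y y)" for y using finB by (simp add: Y_def)

  \<comment> \<open>The integrand when \<open>s\<close> opens its own block, whose coordinate is \<open>x\<close>.\<close>
  define H where "H y x \<omega> = F ((z y)(s := x)) (\<omega> \<union> Y y \<union> (if \<epsilon> s = 1 then {x} else {}))"
    for y x \<omega>
  let ?R = "insert {s} Q"
  have partR: "partition_on ?S ?R" by (rule partition_on_add_singleton[OF part s])
  have bR: "block_of ?R t = block_of Q t" if "t \<in> S" for t
    using block_of_eq[OF partR _ bQ(2)[OF that]] bQ(1)[OF that] by simp
  have bRs: "block_of ?R s = {s}" using block_of_eq[OF partR, of "{s}" s] by simp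
  have bRmem: "block_of ?R t \<in> ?R" if "t \<in> ?S" for t using block_of_mem(1)[OF partR that] .
  have H_eq: "joint_integrand F ?S \<epsilon> (block_of ?R) (y({s} := x)) \<omega> = H y x \<omega>" for y x \<omega>
  proof -
    have upd: "(y({s} := x)) (block_of ?R t) = y (block_of Q t)" if "t \<in> S" for t
      using bR[OF that] bQ(1)[OF that] sQ(1) by auto
    have "(\<lambda>t\<in>?S. (y({s} := x)) (block_of ?R t)) = (z y)(s := x)"
      using upd bRs s by (auto simp: z_def fun_eq_iff)
    moreover have "(\<lambda>t. (y({s} := x)) (block_of ?R t)) ` {t\<in>?S. \<epsilon> t = 1} =
        (\<lambda>t. y (block_of Q t)) ` {t\<in>S. \<epsilon> t = 1} \<union> (if \<epsilon> s = 1 then {x} else {})"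
    proof -
      have "{t\<in>?S. \<epsilon> t = 1} = {t\<in>S. \<epsilon> t = 1} \<union> (if \<epsilon> s = 1 then {s} else {})" by auto
      moreover have "(\<lambda>t. (y({s} := x)) (block_of ?R t)) ` {t\<in>S. \<epsilon> t = 1} = (\<lambda>t. y (block_of Q t)) ` {t\<in>S. \<epsilon> t = 1}"
        using upd by (intro image_cong) auto
      ultimately show ?thesis using bRs by (simp add: image_Un)
    qed
    ultimately show ?thesis
      unfolding joint_integrand_def H_def Y_eq by (simp only: Un_assoc)
  qed
  have term_R: "partition_term F ?S \<epsilon> (block_of ?R) ?R = (\<integral>\<^sup>+y. \<integral>\<^sup>+x. \<integral>\<^sup>+\<omega>. H y x \<omega> \<partial>P \<partial>\<sigma> \<partial>?N)"
    unfolding partition_term_def H_eq[symmetric]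
    by (rule PiS.product_nn_integral_insert[OF finQ sQ(1) measurable_expected_joint_integrand[OF finS bRmem F]])

  \<comment> \<open>The integrand when \<open>s\<close> joins \<open>B\<close>: the point of \<open>B\<close> is already in \<open>Y\<close>.\<close>
  define G where "G y B \<omega> = F ((z y)(s := y B)) (\<omega> \<union> Y y)" for y B \<omega>
  have term_B: "partition_term F ?S \<epsilon> (block_of (insert (insert s B) (Q - {B}))) (insert (insert s B) (Q - {B}))
      = (\<integral>\<^sup>+y. \<integral>\<^sup>+\<omega>. G y B \<omega> \<partial>P \<partial>?N)" 
      and meas_B: "(\<lambda>(y, \<omega>). G y B \<omega>) \<in> borel_measurable (?N \<Otimes>\<^sub>M P)"
    if e: "\<epsilon> s = 1" and Bf: "B \<in> full_blocks \<epsilon> Q" for B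
  proof -
    have B: "B \<in> Q" using Bf by (simp add: full_blocks_def)
    let ?T = "insert (insert s B) (Q - {B})"
    let ?q = "(block_of Q)(s := B)"
    have partT: "partition_on ?S ?T" by (rule partition_on_join_block[OF part s B])
    \<comment> \<open>The partition in which \<open>s\<close> has joined \<open>B\<close> has the same coordinates as \<open>Q\<close>, with \<open>B\<close> renamed.\<close>
    have h: "bij_betw (\<lambda>C. C - {s}) ?T Q"
    proof -
      have "C - {s} = C" if "C \<in> Q" for C using sQ(2)[OF that] by simp
      moreover have "insert s B - {s} = B" using sQ(2)[OF B] by simp
      ultimately show ?thesis
        using B by (intro bij_betw_byWitness[where f'="\<lambda>C. if C = B then insert s B else C"]) auto
    qed
    have bT: "?q t = block_of ?T t - {s}" if "t \<in> ?S" for t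
    proof (cases "t = s \<or> block_of Q t = B")
      case True
      have "t \<in> insert s B" using True bQ(2)[of t] that by auto
      then have "block_of ?T t = insert s B" by (intro block_of_eq[OF partT]) auto
      with True sQ(2)[OF B] show ?thesis by auto
    next
      case False
      then have t: "t \<in> S" using that by auto
      have "block_of ?T t = block_of Q t"
        using False bQ[OF t] by (intro block_of_eq[OF partT]) auto
      with False sQ(2)[OF bQ(1)[OF t]] show ?thesis by auto
    qed
    have finT: "finite ?T" using finQ by simp
    have T_eq: "partition_term F ?S \<epsilon> ?q Q = partition_term F ?S \<epsilon> (block_of ?T) ?T"
      by (rule partition_term_reindex[OF finS finT h block_of_mem(1)[OF partT] bT F])
    have G_eq: "joint_integrand F ?S \<epsilon> ?q y \<omega> = G y B \<omega>" for y \<omega>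
    proof -
      have "(\<lambda>t\<in>?S. y (?q t)) = (z y)(s := y B)"
        using s by (auto simp: z_def fun_eq_iff)
      moreover have "(\<lambda>t. y (?q t)) ` {t\<in>?S. \<epsilon> t = 1} = Y y"
      proof -
        have "{t\<in>?S. \<epsilon> t = 1} = insert s {t\<in>S. \<epsilon> t = 1}" using e by auto
        moreover have "(\<lambda>t. y (?q t)) ` {t\<in>S. \<epsilon> t = 1} = Y y"
          unfolding Y_eq[symmetric] using s by (intro image_cong) auto
        moreover have "y B \<in> Y y" using Bf by (simp add: Y_def)
        ultimately show ?thesis by (simp add: insert_absorb)
      qed
      ultimately show ?thesis by (simp only: joint_integrand_def G_def)
    qed
    show "partition_term F ?S \<epsilon> (block_of ?T) ?T = (\<integral>\<^sup>+y. \<integral>\<^sup>+\<omega>. G y B \<omega> \<partial>P \<partial>?N)"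
      unfolding T_eq[symmetric] unfolding partition_term_def G_eq ..
    have "?q t \<in> Q" if "t \<in> ?S" for t using that B bQ(1) by auto
    from measurable_joint_integrand[where q = ?q and \<epsilon> = \<epsilon>, OF finS this F]
    show "(\<lambda>(y, \<omega>). G y B \<omega>) \<in> borel_measurable (?N \<Otimes>\<^sub>M P)" unfolding G_eq .
  qed

  have slice: "(\<lambda>(x, \<omega>). F ((z y)(s := x)) (\<omega> \<union> Y y)) \<in> borel_measurable (borel \<Otimes>\<^sub>M config_space)" for y
  proof -
    have "(\<lambda>p. snd p \<union> (\<lambda>v. v) ` Y y) \<in> measurable (borel \<Otimes>\<^sub>M config_space) (config_space :: 'a set measure)"
      using finY by (intro measurable_Un_points) auto
    moreover have "z y \<in> space (PiM S (\<lambda>_. borel))" by (simp add: z_def space_PiM)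
    then have "(\<lambda>p. (z y)(s := fst p)) \<in> measurable (borel \<Otimes>\<^sub>M (config_space :: 'a set measure)) (PiM ?S (\<lambda>_. borel))"
      by (intro measurable_fun_upd[where J=S]) auto
    ultimately have "(\<lambda>p. ((z y)(s := fst p), snd p \<union> Y y)) \<in>
       measurable (borel \<Otimes>\<^sub>M config_space) (PiM ?S (\<lambda>_. borel) \<Otimes>\<^sub>M config_space)"
      by (intro measurable_Pair) simp_all
    from measurable_compose[OF this F] show ?thesis by (simp add: case_prod_beta')
  qed
  have slice_x: "(\<lambda>x. F ((z y)(s := x)) (\<omega> \<union> Y y)) \<in> borel_measurable borel" if "\<omega> \<in> configurations" for y \<omega>
    using measurable_compose[OF measurable_Pair2'[of \<omega> config_space borel] slice] that by (simp add: space_config_space)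
  have H_meas: "(\<lambda>y. \<integral>\<^sup>+x. \<integral>\<^sup>+\<omega>. H y x \<omega> \<partial>P \<partial>\<sigma>) \<in> borel_measurable ?N"
  proof -
    have "(\<lambda>p. (fst p)({s} := snd p)) \<in> measurable (?N \<Otimes>\<^sub>M \<sigma>) (PiM ?R (\<lambda>_. \<sigma>))"
      using measurable_add_dim[of "{s}" Q "\<lambda>_. \<sigma>"] by (simp add: case_prod_beta')
    from measurable_compose[OF this
      measurable_expected_joint_integrand[where q = "block_of ?R" and \<epsilon> = \<epsilon>, OF finS bRmem F]]
    have "(\<lambda>(y, x). \<integral>\<^sup>+\<omega>. H y x \<omega> \<partial>P) \<in> borel_measurable (?N \<Otimes>\<^sub>M \<sigma>)"
      by (simp add: case_prod_beta' H_eq)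
    then show ?thesis by (rule S.borel_measurable_nn_integral)
  qed

  have F'_eq: "joint_integrand F' S \<epsilon> (block_of Q) y \<omega> = F' (z y) (\<omega> \<union> Y y)" for y \<omega>
    unfolding joint_integrand_def Y_eq z_def ..
  show ?thesis
  proof (cases "\<epsilon> s = 1")
    case False
    have "(\<integral>\<^sup>+\<omega>. F' (z y) (\<omega> \<union> Y y) \<partial>P) = (\<integral>\<^sup>+x. \<integral>\<^sup>+\<omega>. H y x \<omega> \<partial>P \<partial>\<sigma>)" for y
    proof -
      have "(\<integral>\<^sup>+\<omega>. F' (z y) (\<omega> \<union> Y y) \<partial>P) = (\<integral>\<^sup>+\<omega>. \<integral>\<^sup>+x. H y x \<omega> \<partial>\<sigma> \<partial>P)"
        using False by (simp add: F'_def H_def)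
      also have "\<dots> = (\<integral>\<^sup>+x. \<integral>\<^sup>+\<omega>. H y x \<omega> \<partial>P \<partial>\<sigma>)"
      proof (rule PS.Fubini'[symmetric])
        have "(\<lambda>(x, \<omega>). H y x \<omega>) \<in> borel_measurable (\<sigma> \<Otimes>\<^sub>M P)"
          using slice[of y] False by (simp add: H_def cong: measurable_cong_sets)
        from measurable_pair_swap[OF this]
        show "(\<lambda>(\<omega>, x). H y x \<omega>) \<in> borel_measurable (P \<Otimes>\<^sub>M \<sigma>)"
          by (simp add: case_prod_beta')
      qed
      finally show ?thesis .
    qed
    then show ?thesis
      unfolding term_R using False unfolding partition_term_def F'_eq by simp
  next
    case True
    have null: "AE y in ?N. inj_on y Q"
      by (rule AE_PiM_inj_on[OF S.sigma_finite_measure_axioms sets_intensity intensity_singleton finQ])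
    have inner: "(\<integral>\<^sup>+\<omega>. F' (z y) (\<omega> \<union> Y y) \<partial>P) =
        (\<integral>\<^sup>+x. \<integral>\<^sup>+\<omega>. H y x \<omega> \<partial>P \<partial>\<sigma>) + (\<Sum>B\<in>full_blocks \<epsilon> Q. \<integral>\<^sup>+\<omega>. G y B \<omega> \<partial>P)"
      if y: "y \<in> space ?N" and inj: "inj_on y Q" for y
    proof -
      have inj': "inj_on y (full_blocks \<epsilon> Q)"
        using inj by (rule inj_on_subset) (auto simp: full_blocks_def)
      have "AE \<omega> in P. \<forall>v\<in>Y y. v \<notin> \<omega>"
        using finY AE_avoids_point by (intro AE_finite_allI) auto
      \<comment> \<open>The points of \<open>Y\<close> are outside \<open>\<omega>\<close>, and distinct by injectivity of \<open>y\<close>, so none is counted twice.\<close>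
      then have avoid: "AE \<omega> in P. \<omega> \<inter> Y y = {}"
        by eventually_elim auto
      have Gy: "(\<lambda>\<omega>. G y B \<omega>) \<in> borel_measurable P" if "B \<in> full_blocks \<epsilon> Q" for B
        using measurable_compose[OF measurable_Pair1'[OF y] meas_B[OF True that]] by simp
      have first: "(\<lambda>\<omega>. \<integral>\<^sup>+x. F ((z y)(s := x)) (\<omega> \<union> Y y) \<partial>config_measure \<omega>) \<in> borel_measurable P"
      proof (rule measurable_nn_integral_config_measure[OF locally_compact])
        show "(\<lambda>\<omega>. \<omega>) \<in> measurable P config_space" by (simp cong: measurable_cong_sets)
        show "(\<lambda>(\<omega>, x). F ((z y)(s := x)) (\<omega> \<union> Y y)) \<in> borel_measurable (P \<Otimes>\<^sub>M borel)"
          using measurable_pair_swap[OF slice[of y]] by (simp add: case_prod_beta' cong: measurable_cong_sets)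
      qed
      have "(\<integral>\<^sup>+\<omega>. F' (z y) (\<omega> \<union> Y y) \<partial>P) =
        (\<integral>\<^sup>+\<omega>. (\<integral>\<^sup>+x. F ((z y)(s := x)) (\<omega> \<union> Y y) \<partial>config_measure \<omega>) + (\<Sum>B\<in>full_blocks \<epsilon> Q. G y B \<omega>) \<partial>P)"
      proof (rule nn_integral_cong_AE)
        show "AE \<omega> in P. F' (z y) (\<omega> \<union> Y y) =
            (\<integral>\<^sup>+x. F ((z y)(s := x)) (\<omega> \<union> Y y) \<partial>config_measure \<omega>) + (\<Sum>B\<in>full_blocks \<epsilon> Q. G y B \<omega>)"
          using avoid AE_space
        proof eventually_elim
          case (elim \<omega>)
          then have \<omega>: "\<omega> \<in> configurations" by simp
          have "F' (z y) (\<omega> \<union> Y y) = (\<integral>\<^sup>+x. F ((z y)(s := x)) (\<omega> \<union> Y y) \<partial>config_measure (\<omega> \<union> Y y))"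
            using True by (simp add: F'_def)
          also have "\<dots> = (\<integral>\<^sup>+x. F ((z y)(s := x)) (\<omega> \<union> Y y) \<partial>config_measure \<omega>) +
              (\<Sum>v\<in>Y y. F ((z y)(s := v)) (\<omega> \<union> Y y))"
            by (rule nn_integral_config_measure_Un[OF slice_x[OF \<omega>] finY elim(1)])
          also have "(\<Sum>v\<in>Y y. F ((z y)(s := v)) (\<omega> \<union> Y y)) = (\<Sum>B\<in>full_blocks \<epsilon> Q. G y B \<omega>)"
            unfolding G_def by (subst (1) Y_def) (simp add: sum.reindex[OF inj'])
          finally show ?case .
        qed
      qed
      also have "\<dots> = (\<integral>\<^sup>+\<omega>. \<integral>\<^sup>+x. F ((z y)(s := x)) (\<omega> \<union> Y y) \<partial>config_measure \<omega> \<partial>P) +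
          (\<Sum>B\<in>full_blocks \<epsilon> Q. \<integral>\<^sup>+\<omega>. G y B \<omega> \<partial>P)"
        using first Gy by (simp add: nn_integral_add nn_integral_sum)
      also have "(\<integral>\<^sup>+\<omega>. \<integral>\<^sup>+x. F ((z y)(s := x)) (\<omega> \<union> Y y) \<partial>config_measure \<omega> \<partial>P) =
          (\<integral>\<^sup>+x. \<integral>\<^sup>+\<omega>. H y x \<omega> \<partial>P \<partial>\<sigma>)"
        using mecke[OF slice[of y]] True by (simp add: H_def)
      finally show ?thesis .
    qed
    have "partition_term F' S \<epsilon> (block_of Q) Q =
        (\<integral>\<^sup>+y. (\<integral>\<^sup>+x. \<integral>\<^sup>+\<omega>. H y x \<omega> \<partial>P \<partial>\<sigma>) + (\<Sum>B\<in>full_blocks \<epsilon> Q. \<integral>\<^sup>+\<omega>. G y B \<omega> \<partial>P) \<partial>?N)"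
      unfolding partition_term_def F'_eq
      by (rule nn_integral_cong_AE) (use null AE_space in eventually_elim, rule inner)
    also have "\<dots> = (\<integral>\<^sup>+y. \<integral>\<^sup>+x. \<integral>\<^sup>+\<omega>. H y x \<omega> \<partial>P \<partial>\<sigma> \<partial>?N) +
        (\<Sum>B\<in>full_blocks \<epsilon> Q. \<integral>\<^sup>+y. \<integral>\<^sup>+\<omega>. G y B \<omega> \<partial>P \<partial>?N)"
    proof -
      have "(\<lambda>y. \<integral>\<^sup>+\<omega>. G y B \<omega> \<partial>P) \<in> borel_measurable ?N" if "B \<in> full_blocks \<epsilon> Q" for B
        by (rule P.borel_measurable_nn_integral[OF meas_B[OF True that]])
      then show ?thesis
        using H_meas by (simp add: nn_integral_add nn_integral_sum)
    qed
    finally show ?thesis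
      using True term_R term_B by simp
  qed
qed

text \<open>Integrating out the coordinate of the new index first leaves a function of the other coordinates
and the configuration, to which the induction hypothesis applies; \<open>partition_term_insert\<close> then splits
each of its terms.\<close>

theorem expectation_mixed_integral:
  assumes S: "finite S"
    and F: "(\<lambda>(z, \<omega>). F z \<omega>) \<in> borel_measurable (PiM S (\<lambda>_. borel) \<Otimes>\<^sub>M config_space)"
  shows "(\<integral>\<^sup>+\<omega>. \<integral>\<^sup>+z. F z \<omega> \<partial>PiM S (\<lambda>s. if \<epsilon> s = 1 then config_measure \<omega> else \<sigma>) \<partial>P) =
    (\<Sum>Q\<in>typed_partitions S \<epsilon>. partition_term F S \<epsilon> (block_of Q) Q)"
  using assms
proof (induction S arbitrary: F rule: finite_induct)
  case empty
  have "typed_partitions {} \<epsilon> = {{}}"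
    by (auto simp: typed_partitions_def partition_on_empty)
  then show ?case
    by (simp add: PiM_empty nn_integral_count_space_finite partition_term_def joint_integrand_def)
next
  case (insert s S)
  define F' where "F' z \<omega> = (\<integral>\<^sup>+x. F (z(s := x)) \<omega> \<partial>(if \<epsilon> s = 1 then config_measure \<omega> else \<sigma>))" for z \<omega>
  have F': "(\<lambda>(z, \<omega>). F' z \<omega>) \<in> borel_measurable (PiM S (\<lambda>_. borel) \<Otimes>\<^sub>M config_space)"
    unfolding F'_def by (rule measurable_nn_integral_coordinate[OF insert.prems])
  have "(\<integral>\<^sup>+\<omega>. \<integral>\<^sup>+z. F z \<omega> \<partial>PiM (insert s S) (\<lambda>s. if \<epsilon> s = 1 then config_measure \<omega> else \<sigma>) \<partial>P) =
      (\<integral>\<^sup>+\<omega>. \<integral>\<^sup>+z. F' z \<omega> \<partial>PiM S (\<lambda>s. if \<epsilon> s = 1 then config_measure \<omega> else \<sigma>) \<partial>P)"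
  proof (rule nn_integral_cong)
    fix \<omega> assume "\<omega> \<in> space P"
    then have \<omega>: "\<omega> \<in> configurations" by simp
    interpret M: product_sigma_finite "\<lambda>s. if \<epsilon> s = 1 then config_measure \<omega> else \<sigma>"
      by (rule sigma_finite_mixed[OF \<omega>])
    have "(\<lambda>z. F z \<omega>) \<in> borel_measurable (PiM (insert s S) (\<lambda>_. borel))"
      using measurable_compose[OF measurable_Pair2'[of \<omega> config_space] insert.prems] \<omega>
      by (simp add: space_config_space)
    then have "(\<lambda>z. F z \<omega>) \<in> borel_measurable (PiM (insert s S) (\<lambda>s. if \<epsilon> s = 1 then config_measure \<omega> else \<sigma>))"
      by (subst measurable_cong_sets[OF sets_PiM_mixed refl])
    then show "(\<integral>\<^sup>+z. F z \<omega> \<partial>PiM (insert s S) (\<lambda>s. if \<epsilon> s = 1 then config_measure \<omega> else \<sigma>)) =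
        (\<integral>\<^sup>+z. F' z \<omega> \<partial>PiM S (\<lambda>s. if \<epsilon> s = 1 then config_measure \<omega> else \<sigma>))"
      unfolding F'_def by (rule M.product_nn_integral_insert[OF insert.hyps])
  qed
  also have "\<dots> = (\<Sum>Q\<in>typed_partitions S \<epsilon>. partition_term F' S \<epsilon> (block_of Q) Q)"
    by (rule insert.IH[OF F'])
  also have "\<dots> = (\<Sum>R\<in>typed_partitions (insert s S) \<epsilon>. partition_term F (insert s S) \<epsilon> (block_of R) R)"
    unfolding sum_typed_partitions_insert[OF insert.hyps]
    unfolding F'_def[abs_def] by (intro sum.cong refl partition_term_insert[OF insert.hyps _ insert.prems])
  finally show ?case .
qed

end

section \<open>Products of integrals of processes\<close>

lemma finite_index_set: "finite (index_set l r n)"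
  by (rule finite_subset[of _ "{1..l} \<times> (\<Union>\<alpha>\<in>{1..l}. {1..r \<alpha>}) \<times> (\<Union>\<alpha>\<in>{1..l}. {1..n \<alpha>})"])
    (auto simp: index_set_def)

lemma index_set_eq_UN:
  "index_set l r n = (\<Union>(\<alpha>, \<gamma>)\<in>(SIGMA \<alpha>:{1..l}. {1..n \<alpha>}). (\<lambda>\<beta>. (\<alpha>, \<beta>, \<gamma>)) ` {1..r \<alpha>})"
  by (auto simp: index_set_def image_iff)

lemma process_section:
  assumes "process k f" "\<omega> \<in> configurations"
  shows "(\<lambda>y. f y \<omega>) \<in> borel_measurable (PiM {1..k} (\<lambda>_. borel))"
  using measurable_compose[OF measurable_Pair2'[of \<omega> config_space] assms(1)[unfolded process_def]] assms(2)
  by (simp add: space_config_space)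

definition process_product ::
  "nat \<Rightarrow> (nat \<Rightarrow> nat) \<Rightarrow> (nat \<Rightarrow> nat) \<Rightarrow> (nat \<Rightarrow> (nat \<Rightarrow> 'a) \<Rightarrow> 'a set \<Rightarrow> ennreal) \<Rightarrow>
    (nat \<times> nat \<times> nat \<Rightarrow> 'a) \<Rightarrow> 'a set \<Rightarrow> ennreal" where
  "process_product l r n f z \<omega> = (\<Prod>\<alpha>=1..l. \<Prod>\<gamma>=1..n \<alpha>. f \<alpha> (\<lambda>\<beta>\<in>{1..r \<alpha>}. z (\<alpha>, \<beta>, \<gamma>)) \<omega>)"

lemma measurable_process_product:
  assumes f: "\<And>\<alpha>. \<alpha> \<in> {1..l} \<Longrightarrow> process (r \<alpha>) (f \<alpha>)"
  shows "(\<lambda>(z, \<omega>). process_product l r n f z \<omega>)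
    \<in> borel_measurable (PiM (index_set l r n) (\<lambda>_. borel) \<Otimes>\<^sub>M config_space)"
proof -
  let ?N = "PiM (index_set l r n) (\<lambda>_. borel) \<Otimes>\<^sub>M config_space"
  have "(\<lambda>p. f \<alpha> (\<lambda>\<beta>\<in>{1..r \<alpha>}. fst p (\<alpha>, \<beta>, \<gamma>)) (snd p)) \<in> borel_measurable ?N"
    if "\<alpha> \<in> {1..l}" "\<gamma> \<in> {1..n \<alpha>}" for \<alpha> \<gamma>
  proof -
    have "(\<lambda>p. fst p (\<alpha>, \<beta>, \<gamma>)) \<in> borel_measurable ?N" if "\<beta> \<in> {1..r \<alpha>}" for \<beta>
      using \<open>\<alpha> \<in> {1..l}\<close> \<open>\<gamma> \<in> {1..n \<alpha>}\<close> that
      by (intro measurable_compose[OF measurable_fst measurable_component_singleton]) (simp add: index_set_def)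
    then have "(\<lambda>p. (\<lambda>\<beta>\<in>{1..r \<alpha>}. fst p (\<alpha>, \<beta>, \<gamma>), snd p))
        \<in> measurable ?N (PiM {1..r \<alpha>} (\<lambda>_. borel) \<Otimes>\<^sub>M config_space)"
      by (intro measurable_Pair measurable_restrict measurable_snd)
    from measurable_compose[OF this f[OF that(1), unfolded process_def]] show ?thesis
      by simp
  qed
  then show ?thesis
    unfolding process_product_def case_prod_beta' by (intro borel_measurable_prod_ennreal)
qed

context poisson_process
begin

text \<open>The power \<open>n\<^sub>\<alpha>\<close> is a product over \<open>\<gamma>\<close> of equal integrals, each of which is an integral over its own
group of coordinates \<open>(\<alpha>, \<beta>, \<gamma>)\<close>. The groups are disjoint and exhaust the index set.\<close>

lemma power_integrals_eq_integral_product: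
  assumes \<omega>: "\<omega> \<in> configurations"
    and f: "\<And>\<alpha>. \<alpha> \<in> {1..l} \<Longrightarrow> process (r \<alpha>) (f \<alpha>)"
  shows "(\<Prod>\<alpha>=1..l. (\<integral>\<^sup>+y. f \<alpha> y \<omega> \<partial>mixed_measure \<sigma> \<omega> (\<epsilon> \<alpha>) (r \<alpha>)) ^ n \<alpha>) =
    (\<integral>\<^sup>+z. process_product l r n f z \<omega>
      \<partial>PiM (index_set l r n) (\<lambda>s. if index_type \<epsilon> s = 1 then config_measure \<omega> else \<sigma>))"
proof -
  let ?M = "\<lambda>s. if index_type \<epsilon> s = 1 then config_measure \<omega> else \<sigma>"
  let ?A = "SIGMA \<alpha>:{1..l}. {1..n \<alpha>}"
  let ?J = "\<lambda>(\<alpha>, \<gamma>). (\<lambda>\<beta>. (\<alpha>, \<beta>, \<gamma>)) ` {1..r \<alpha>}"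
  let ?F = "\<lambda>(\<alpha>, \<gamma>) z. f \<alpha> (\<lambda>\<beta>\<in>{1..r \<alpha>}. z (\<alpha>, \<beta>, \<gamma>)) \<omega>"
  interpret M: product_sigma_finite ?M by (rule sigma_finite_mixed[OF \<omega>])
  have M_eq: "mixed_measure \<sigma> \<omega> (\<epsilon> \<alpha>) (r \<alpha>) = PiM {1..r \<alpha>} (\<lambda>\<beta>. ?M (\<alpha>, \<beta>, \<gamma>))" for \<alpha> \<gamma>
    by (simp add: mixed_measure_def index_type_def)
  have f_meas: "(\<lambda>y. f \<alpha> y \<omega>) \<in> borel_measurable (PiM {1..r \<alpha>} (\<lambda>\<beta>. ?M (\<alpha>, \<beta>, \<gamma>)))"
    if "\<alpha> \<in> {1..l}" for \<alpha> \<gamma>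
  proof -
    have "sets (PiM {1..r \<alpha>} (\<lambda>\<beta>. ?M (\<alpha>, \<beta>, \<gamma>))) = sets (PiM {1..r \<alpha>} (\<lambda>_. borel))"
      by (rule sets_PiM_cong) auto
    from measurable_cong_sets[OF this refl] process_section[OF f[OF that] \<omega>] show ?thesis
      by blast
  qed
  have single: "(\<integral>\<^sup>+y. f \<alpha> y \<omega> \<partial>mixed_measure \<sigma> \<omega> (\<epsilon> \<alpha>) (r \<alpha>)) = (\<integral>\<^sup>+z. ?F (\<alpha>, \<gamma>) z \<partial>PiM (?J (\<alpha>, \<gamma>)) ?M)"
    if "\<alpha> \<in> {1..l}" for \<alpha> \<gamma>
  proof -
    have "bij_betw (\<lambda>\<beta>. (\<alpha>, \<beta>, \<gamma>)) {1..r \<alpha>} (?J (\<alpha>, \<gamma>))"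
      by (auto simp: bij_betw_def inj_on_def)
    from M.product_nn_integral_reindex[OF _ this f_meas[OF that]] show ?thesis
      by (simp add: M_eq[of \<alpha> \<gamma>])
  qed
  have F_meas: "?F a \<in> borel_measurable (PiM (?J a) ?M)" if "a \<in> ?A" for a
  proof -
    obtain \<alpha> \<gamma> where a: "a = (\<alpha>, \<gamma>)" by (cases a)
    then have \<alpha>: "\<alpha> \<in> {1..l}" using that by simp
    have "(\<lambda>z. \<lambda>\<beta>\<in>{1..r \<alpha>}. z (\<alpha>, \<beta>, \<gamma>)) \<in> measurable (PiM (?J a) ?M) (PiM {1..r \<alpha>} (\<lambda>\<beta>. ?M (\<alpha>, \<beta>, \<gamma>)))"
      using a by (intro measurable_restrict measurable_component_singleton) auto
    from measurable_compose[OF this f_meas[OF \<alpha>]] show ?thesis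
      using a by simp
  qed
  have "(\<Prod>\<alpha>=1..l. (\<integral>\<^sup>+y. f \<alpha> y \<omega> \<partial>mixed_measure \<sigma> \<omega> (\<epsilon> \<alpha>) (r \<alpha>)) ^ n \<alpha>) =
      (\<Prod>\<alpha>=1..l. \<Prod>\<gamma>=1..n \<alpha>. \<integral>\<^sup>+z. ?F (\<alpha>, \<gamma>) z \<partial>PiM (?J (\<alpha>, \<gamma>)) ?M)"
    using single by (intro prod.cong refl) (simp flip: single)
  also have "\<dots> = (\<Prod>a\<in>?A. \<integral>\<^sup>+z. ?F a z \<partial>PiM (?J a) ?M)"
    by (subst prod.Sigma) (auto intro!: prod.cong)
  also have "\<dots> = (\<integral>\<^sup>+z. (\<Prod>a\<in>?A. ?F a (restrict z (?J a))) \<partial>PiM (\<Union>a\<in>?A. ?J a) ?M)"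
    by (rule M.prod_nn_integral_groups[OF _ _ _ F_meas]) (auto simp: disjoint_family_on_def)
  also have "(\<Union>a\<in>?A. ?J a) = index_set l r n"
    by (simp add: index_set_eq_UN)
  also have "(\<integral>\<^sup>+z. (\<Prod>a\<in>?A. ?F a (restrict z (?J a))) \<partial>PiM (index_set l r n) ?M) =
      (\<integral>\<^sup>+z. process_product l r n f z \<omega> \<partial>PiM (index_set l r n) ?M)"
  proof (rule nn_integral_cong)
    fix z :: "nat \<times> nat \<times> nat \<Rightarrow> 'a"
    have "(\<lambda>\<beta>\<in>{1..r \<alpha>}. restrict z (?J (\<alpha>, \<gamma>)) (\<alpha>, \<beta>, \<gamma>)) = (\<lambda>\<beta>\<in>{1..r \<alpha>}. z (\<alpha>, \<beta>, \<gamma>))" for \<alpha> \<gamma>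
      by (auto simp: fun_eq_iff)
    then have "(\<Prod>a\<in>?A. ?F a (restrict z (?J a))) = (\<Prod>a\<in>?A. ?F a z)"
      by (intro prod.cong) auto
    also have "\<dots> = process_product l r n f z \<omega>"
      unfolding process_product_def by (subst prod.Sigma) (auto intro!: prod.cong)
    finally show "(\<Prod>a\<in>?A. ?F a (restrict z (?J a))) = process_product l r n f z \<omega>" .
  qed
  finally show ?thesis .
qed

text \<open>Passing from blocks to their enumeration is a renaming of coordinates, and the restriction to tuples of
distinct points removes a null set.\<close>

lemma partition_term_distinct_tuples:
  fixes F :: "('i \<Rightarrow> 'a) \<Rightarrow> 'a set \<Rightarrow> ennreal"
  assumes S: "finite S" and Q: "partition_on S Q" and b: "bij_betw b {1..card Q} Q"
    and F: "(\<lambda>(z, \<omega>). F z \<omega>) \<in> borel_measurable (PiM S (\<lambda>_. borel) \<Otimes>\<^sub>M config_space)"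
  shows "partition_term F S \<epsilon> (block_of Q) Q =
    (\<integral>\<^sup>+\<omega>. (\<integral>\<^sup>+y\<in>distinct_tuples (card Q).
      F (restrict (block_vector (card Q) b y) S) (added_config \<omega> S \<epsilon> (block_vector (card Q) b y))
      \<partial>PiM {1..card Q} (\<lambda>_. \<sigma>)) \<partial>P)"
proof -
  let ?k = "card Q"
  let ?N = "PiM {1..?k} (\<lambda>_. \<sigma>)"
  define q where "q s = (THE j. j \<in> {1..?k} \<and> s \<in> b j)" for s
  have q: "q s \<in> {1..?k}" "block_of Q s = b (q s)" if s: "s \<in> S" for s
  proof -
    have "\<exists>!j. j \<in> {1..?k} \<and> s \<in> b j"
    proof -
      obtain j where j: "j \<in> {1..?k}" "b j = block_of Q s"
        using b block_of_mem(1)[OF Q s] by (metis bij_betw_iff_bijections)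
      moreover have "i = j" if i: "i \<in> {1..?k}" "s \<in> b i" for i
      proof -
        have "b i \<in> Q" using b i(1) bij_betwE by blast
        then have "b i = b j" using block_of_eq[OF Q _ i(2)] j(2) by simp
        then show ?thesis using b i(1) j(1) by (metis bij_betw_imp_inj_on inj_onD)
      qed
      ultimately show ?thesis using block_of_mem(2)[OF Q s] by metis
    qed
    from theI'[OF this] have *: "q s \<in> {1..?k}" "s \<in> b (q s)" unfolding q_def by auto
    then show "q s \<in> {1..?k}" by simp
    have "b (q s) \<in> Q" using b *(1) bij_betwE by blast
    then show "block_of Q s = b (q s)" using block_of_eq[OF Q _ *(2)] by simp
  qed
  have integrand: "joint_integrand F S \<epsilon> q y \<omega> =
      F (restrict (block_vector ?k b y) S) (added_config \<omega> S \<epsilon> (block_vector ?k b y))" for y \<omega>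
    by (simp add: joint_integrand_def added_config_def block_vector_def[abs_def] q_def UNION_singleton_eq_range)
  interpret N: sigma_finite_measure ?N
    by (rule PiS.sigma_finite) simp
  interpret PN: pair_sigma_finite P ?N ..
  have m: "(\<lambda>(y, \<omega>). joint_integrand F S \<epsilon> q y \<omega>) \<in> borel_measurable (?N \<Otimes>\<^sub>M P)"
    by (rule measurable_joint_integrand[OF S q(1) F])
  have "AE y in ?N. inj_on y {1..?k}"
    by (rule AE_PiM_inj_on[OF S.sigma_finite_measure_axioms sets_intensity intensity_singleton]) simp
  then have dist: "AE y in ?N. y \<in> distinct_tuples ?k"
    using AE_space by eventually_elim (auto simp: distinct_tuples_def space_PiM)
  have "partition_term F S \<epsilon> (block_of Q) Q = partition_term F S \<epsilon> q {1..?k}"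
    by (rule partition_term_reindex[OF S _ b q F]) simp
  also have "\<dots> = (\<integral>\<^sup>+\<omega>. \<integral>\<^sup>+y. joint_integrand F S \<epsilon> q y \<omega> \<partial>?N \<partial>P)"
    unfolding partition_term_def
  proof (rule PN.Fubini')
    show "(\<lambda>(\<omega>, y). joint_integrand F S \<epsilon> q y \<omega>) \<in> borel_measurable (P \<Otimes>\<^sub>M ?N)"
      using measurable_pair_swap[OF m] by (simp add: case_prod_beta')
  qed
  also have "\<dots> = (\<integral>\<^sup>+\<omega>. (\<integral>\<^sup>+y\<in>distinct_tuples ?k. joint_integrand F S \<epsilon> q y \<omega> \<partial>?N) \<partial>P)"
    by (rule nn_integral_cong, rule nn_integral_cong_AE) (use dist in eventually_elim, simp)
  finally show ?thesis unfolding integrand .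
qed

end

theorem theorem3p1:
  fixes \<sigma> :: "'a::{metric_space, second_countable_topology} measure"
    and P :: "'a set measure"
    and l :: nat and r n :: "nat \<Rightarrow> nat"
    and f\<^sub>0 :: "'a set \<Rightarrow> ennreal"
    and f :: "nat \<Rightarrow> (nat \<Rightarrow> 'a) \<Rightarrow> 'a set \<Rightarrow> ennreal"
    and \<epsilon> :: "nat \<Rightarrow> nat \<Rightarrow> nat"
    and blocks :: "(nat \<times> nat \<times> nat) set set \<Rightarrow> nat \<Rightarrow> (nat \<times> nat \<times> nat) set"
  defines "S \<equiv> index_set l r n"
    and "\<epsilon>S \<equiv> index_type \<epsilon>"
  assumes "locally_compact_space (euclidean :: 'a topology)"
    and "sets \<sigma> = sets borel" and "non_atomic \<sigma>"
    and "\<And>K. compact K \<Longrightarrow> emeasure \<sigma> K < \<infinity>"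
    and "poisson_random_measure \<sigma> P"
    and "l \<ge> 1"
    and "\<And>\<alpha>. \<alpha> \<in> {1..l} \<Longrightarrow> r \<alpha> \<ge> 1"
    and "\<And>\<alpha>. \<alpha> \<in> {1..l} \<Longrightarrow> n \<alpha> \<ge> 1"
    and "f\<^sub>0 \<in> borel_measurable config_space"
    and "\<And>\<alpha>. \<alpha> \<in> {1..l} \<Longrightarrow> process (r \<alpha>) (f \<alpha>)"
    and "\<And>\<alpha> \<beta>. \<alpha> \<in> {1..l} \<Longrightarrow> \<beta> \<in> {1..r \<alpha>} \<Longrightarrow> \<epsilon> \<alpha> \<beta> \<in> {0, 1}"
    and "\<And>\<P>. \<P> \<in> typed_partitions S \<epsilon>S \<Longrightarrow> bij_betw (blocks \<P>) {1..card \<P>} \<P>"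
  shows "(\<integral>\<^sup>+\<omega>. f\<^sub>0 \<omega> * (\<Prod>\<alpha>=1..l. (\<integral>\<^sup>+y. f \<alpha> y \<omega> \<partial>mixed_measure \<sigma> \<omega> (\<epsilon> \<alpha>) (r \<alpha>)) ^ n \<alpha>) \<partial>P) =
    (\<Sum>\<P>\<in>typed_partitions S \<epsilon>S.
      \<integral>\<^sup>+\<omega>. (\<integral>\<^sup>+y\<in>distinct_tuples (card \<P>).
        (let yP = block_vector (card \<P>) (blocks \<P>) y; \<omega>' = added_config \<omega> S \<epsilon>S yP in
          f\<^sub>0 \<omega>' * (\<Prod>\<alpha>=1..l. \<Prod>\<gamma>=1..n \<alpha>. f \<alpha> (\<lambda>\<beta>\<in>{1..r \<alpha>}. yP (\<alpha>, \<beta>, \<gamma>)) \<omega>'))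
        \<partial>(\<Pi>\<^sub>M i\<in>{1..card \<P>}. \<sigma>)) \<partial>P)"
proof -
  interpret poisson_process \<sigma> P
    using assms(3-7) by unfold_locales auto
  define F where "F z \<omega> = f\<^sub>0 \<omega> * process_product l r n f z \<omega>" for z \<omega>
  have S: "finite S" unfolding S_def by (rule finite_index_set)
  have F: "(\<lambda>(z, \<omega>). F z \<omega>) \<in> borel_measurable (PiM S (\<lambda>_. borel) \<Otimes>\<^sub>M config_space)"
  proof -
    have "(\<lambda>p. f\<^sub>0 (snd p)) \<in> borel_measurable (PiM S (\<lambda>_. borel) \<Otimes>\<^sub>M config_space)"
      using measurable_compose[OF measurable_snd assms(11)] .
    then show ?thesis
      using measurable_process_product[of l r f n] assms(12)
      unfolding F_def case_prod_beta' S_def by (intro borel_measurable_times_ennreal) auto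
  qed
  let ?M = "\<lambda>\<omega> s. if \<epsilon>S s = 1 then config_measure \<omega> else \<sigma>"
  have "(\<integral>\<^sup>+\<omega>. f\<^sub>0 \<omega> * (\<Prod>\<alpha>=1..l. (\<integral>\<^sup>+y. f \<alpha> y \<omega> \<partial>mixed_measure \<sigma> \<omega> (\<epsilon> \<alpha>) (r \<alpha>)) ^ n \<alpha>) \<partial>P) =
      (\<integral>\<^sup>+\<omega>. \<integral>\<^sup>+z. F z \<omega> \<partial>PiM S (?M \<omega>) \<partial>P)"
  proof (rule nn_integral_cong)
    fix \<omega> assume "\<omega> \<in> space P"
    then have \<omega>: "\<omega> \<in> configurations" by simp
    have "(\<lambda>z. process_product l r n f z \<omega>) \<in> borel_measurable (PiM S (\<lambda>_. borel))"
      using measurable_compose[OF measurable_Pair2'[of \<omega> config_space] measurable_process_product[of l r f n]]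
        assms(12) \<omega> by (simp add: space_config_space S_def)
    then have "(\<lambda>z. process_product l r n f z \<omega>) \<in> borel_measurable (PiM S (?M \<omega>))"
      by (subst measurable_cong_sets[OF sets_PiM_mixed refl])
    then show "f\<^sub>0 \<omega> * (\<Prod>\<alpha>=1..l. (\<integral>\<^sup>+y. f \<alpha> y \<omega> \<partial>mixed_measure \<sigma> \<omega> (\<epsilon> \<alpha>) (r \<alpha>)) ^ n \<alpha>) =
        (\<integral>\<^sup>+z. F z \<omega> \<partial>PiM S (?M \<omega>))"
      using power_integrals_eq_integral_product[OF \<omega>, of l r f \<epsilon> n] assms(12)
      unfolding F_def S_def \<epsilon>S_def by (subst nn_integral_cmult) simp_all
  qed
  also have "\<dots> = (\<Sum>\<P>\<in>typed_partitions S \<epsilon>S. partition_term F S \<epsilon>S (block_of \<P>) \<P>)"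
    by (rule expectation_mixed_integral[OF S F])
  also have "\<dots> = (\<Sum>\<P>\<in>typed_partitions S \<epsilon>S.
      \<integral>\<^sup>+\<omega>. (\<integral>\<^sup>+y\<in>distinct_tuples (card \<P>).
        (let yP = block_vector (card \<P>) (blocks \<P>) y; \<omega>' = added_config \<omega> S \<epsilon>S yP in
          f\<^sub>0 \<omega>' * (\<Prod>\<alpha>=1..l. \<Prod>\<gamma>=1..n \<alpha>. f \<alpha> (\<lambda>\<beta>\<in>{1..r \<alpha>}. yP (\<alpha>, \<beta>, \<gamma>)) \<omega>'))
        \<partial>(\<Pi>\<^sub>M i\<in>{1..card \<P>}. \<sigma>)) \<partial>P)"
  proof (rule sum.cong[OF refl])
    fix \<P> assume \<P>: "\<P> \<in> typed_partitions S \<epsilon>S"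
    then have part: "partition_on S \<P>" by (simp add: typed_partitions_def)
    have "process_product l r n f (restrict z S) \<omega> =
        (\<Prod>\<alpha>=1..l. \<Prod>\<gamma>=1..n \<alpha>. f \<alpha> (\<lambda>\<beta>\<in>{1..r \<alpha>}. z (\<alpha>, \<beta>, \<gamma>)) \<omega>)" for z \<omega>
    proof -
      have "(\<lambda>\<beta>\<in>{1..r \<alpha>}. restrict z S (\<alpha>, \<beta>, \<gamma>)) = (\<lambda>\<beta>\<in>{1..r \<alpha>}. z (\<alpha>, \<beta>, \<gamma>))"
        if "\<alpha> \<in> {1..l}" "\<gamma> \<in> {1..n \<alpha>}" for \<alpha> \<gamma>
        using that by (auto simp: fun_eq_iff S_def index_set_def)
      then show ?thesis unfolding process_product_def by (intro prod.cong refl) simp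
    qed
    then show "partition_term F S \<epsilon>S (block_of \<P>) \<P> =
      (\<integral>\<^sup>+\<omega>. (\<integral>\<^sup>+y\<in>distinct_tuples (card \<P>).
        (let yP = block_vector (card \<P>) (blocks \<P>) y; \<omega>' = added_config \<omega> S \<epsilon>S yP in
          f\<^sub>0 \<omega>' * (\<Prod>\<alpha>=1..l. \<Prod>\<gamma>=1..n \<alpha>. f \<alpha> (\<lambda>\<beta>\<in>{1..r \<alpha>}. yP (\<alpha>, \<beta>, \<gamma>)) \<omega>'))
        \<partial>(\<Pi>\<^sub>M i\<in>{1..card \<P>}. \<sigma>)) \<partial>P)"
      unfolding partition_term_distinct_tuples[OF S part assms(14)[OF \<P>] F] F_def Let_def by simp
  qed
  finally show ?thesis .
qed

end
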